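(* Let $\pi\in\mathcal{S}_n$ and let $a$ be the sequence \[ a = \begin{cases}z_{[m,n)}\, \overline{z_{[\ell,n)}} & \mbox{if $n-m$ is even, $\pi(n) \ne 1$, and $\pi$ is not collapsed}, \\ \overline{z_{[m,n)} 0} & \mbox{if $n-m$ is even and}\ \pi(n) = 1, \\ \min_{0\le i<|r-\ell|} z^{(i)}_{[m,n)}\, \overline{z^{(i)}_{[\ell,n)}} & \mbox{if $n-m$ is even and $\pi$ is collapsed}, \\ z_{[m,n)}\, \overline{z_{[r,n)}} & \mbox{if $n-m$ is odd and $\pi$ is not collapsed}, \\ \min_{0\le i<|r-\ell|} z^{(i)}_{[m,n)}\, \overline{z^{(i)}_{[r,n)}} & \mbox{if $n-m$ is odd and $\pi$ is collapsed}\end{cases} \] (minima in the alternating lexicographical order). Then $B_-(\pi)=1$ if and only if $a=\overline{\varphi^k(0)}$ for some $k\ge0$.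
   Context: $\mathcal{S}_n$ is the symmetric group on $\{1,\dots,n\}$. For an ordered set $X$, $f:X\to X$, $x$ with $f^0(x),\dots,f^{n-1}(x)$ distinct, $\mathrm{Pat}(x,f,n)=\pi$ means $\pi(i)<\pi(j)$ exactly when $f^{i-1}(x)<f^{j-1}(x)$; $\mathcal{A}(f)$ is the set of all such patterns over all $x$, $n$. For $\beta>1$, $T_{-\beta}:(0,1]\to(0,1]$, $x\mapsto\lfloor\beta x\rfloor+1-\beta x$, and $B_-(\pi)=\inf\{\beta>1:\pi\in\mathcal{A}(T_{-\beta})\}$. Alternating lexicographical order: $v_1v_2\cdots<w_1w_2\cdots$ if for some $k$, $v_{[1,k)}=w_{[1,k)}$ and $v_k<w_k$ for odd $k$, $w_k<v_k$ for even $k$. Notation $w_{[i,j)}=w_i\cdots w_{j-1}$, $\overline v=vvv\cdots$. $\varphi$ is the substitution $0\mapsto1$, $1\mapsto100$ (so $\varphi^0(0)=0$, $\varphi(0)=1$, $\varphi^2(0)=100$, ...). For $\pi\in\mathcal{S}_n$: $m=\pi^{-1}(n)$; $\ell=\pi^{-1}(\pi(n)-1)$ if $\pi(n)\ne1$; $r=\pi^{-1}(\pi(n)+1)$ if $\pi(n)\ne n$. For $1\le j<n$, $z_j=\#\{1\le i<\pi(j):\ (i\ne\pi(n)\ne i+1$ and $\pi(\pi^{-1}(i)+1)<\pi(\pi^{-1}(i+1)+1))$ or $(i+1=\pi(n)\ne n$ and $\pi(\ell+1)<\pi(r+1))\}$. $\pi$ is collapsed if $\pi(n)\notin\{1,n\}$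 and $z_{[\ell,n)}=z_{[r,n)}z_{[r,n)}$ or $z_{[r,n)}=z_{[\ell,n)}z_{[\ell,n)}$. Then for $0\le i<|r-\ell|$, $1\le j<n$: $z^{(i)}_j=z_j+1$ if ($\pi(j)\ge\pi(r+i)$, $i$ even) or ($\pi(j)\ge\pi(\ell+i)$, $i$ odd), else $z^{(i)}_j=z_j$. *)

theory Defs
  imports
    Complex_Main
    "HOL-Library.Extended_Real"
    "HOL-Library.Stream"
    "HOL-Combinatorics.Permutations"
begin

section \<open>Patterns and the negative beta-transformation\<close>

text \<open>
  A permutation in the symmetric group on \<open>{1..n}\<close> is a function \<open>\<pi>\<close> with
  \<open>\<pi> permutes {1..n}\<close>.  Such a function does not determine \<open>n\<close>, so \<open>n\<close> is always passed along.
\<close>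

definition has_pattern :: "('a::linorder \<Rightarrow> 'a) \<Rightarrow> 'a \<Rightarrow> nat \<Rightarrow> (nat \<Rightarrow> nat) \<Rightarrow> bool" where
  "has_pattern f x n \<pi> \<longleftrightarrow>
     \<pi> permutes {1..n} \<and>
     inj_on (\<lambda>i. (f ^^ i) x) {0..<n} \<and>
     (\<forall>i\<in>{1..n}. \<forall>j\<in>{1..n}. \<pi> i < \<pi> j \<longleftrightarrow> (f ^^ (i - 1)) x < (f ^^ (j - 1)) x)"

definition allowed_patterns ::
    "'a::linorder set \<Rightarrow> ('a \<Rightarrow> 'a) \<Rightarrow> nat \<Rightarrow> (nat \<Rightarrow> nat) set" where
  "allowed_patterns X f n = {\<pi>. \<exists>x\<in>X. has_pattern f x n \<pi>}"

definition neg_beta :: "real \<Rightarrow> real \<Rightarrow> real" where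
  "neg_beta \<beta> x = of_int \<lfloor>\<beta> * x\<rfloor> + 1 - \<beta> * x"

lemma neg_beta_in: "neg_beta \<beta> x \<in> {0<..1}"
  unfolding neg_beta_def using floor_correct[of "\<beta> * x"] by (simp add: algebra_simps)

text \<open>
  The infimum is taken in the extended reals, so that it would be \<open>\<infinity>\<close> if no \<open>\<beta>\<close> qualified.
\<close>

definition B_minus :: "nat \<Rightarrow> (nat \<Rightarrow> nat) \<Rightarrow> ereal" where
  "B_minus n \<pi> =
     (INF \<beta>\<in>{\<beta>::real. 1 < \<beta> \<and> \<pi> \<in> allowed_patterns {0<..1} (neg_beta \<beta>) n}. ereal \<beta>)"

section \<open>Alternating lexicographical order\<close>

text \<open>
  Streams are indexed from \<open>0\<close>, so the even indices here are the odd positions when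
  sequences are numbered from \<open>1\<close>.
\<close>

definition altlex :: "nat stream \<Rightarrow> nat stream \<Rightarrow> bool" where
  "altlex v w \<longleftrightarrow>
     (\<exists>k. (\<forall>i<k. v !! i = w !! i) \<and>
          (if even k then v !! k < w !! k else w !! k < v !! k))"

definition altlex_min :: "nat stream set \<Rightarrow> nat stream" where
  "altlex_min S = (THE v. v \<in> S \<and> (\<forall>w\<in>S. v = w \<or> altlex v w))"

lemma altlex_irrefl: "\<not> altlex v v"
  by (auto simp: altlex_def)

lemma altlex_trans:
  assumes "altlex u v" "altlex v w"
  shows "altlex u w"
proof -
  obtain k where k: "\<forall>i<k. u !! i = v !! i"
      "if even k then u !! k < v !! k else v !! k < u !! k"
    using assms(1) by (auto simp: altlex_def)
  obtain l where l: "\<forall>i<l. v !! i = w !! i"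
      "if even l then v !! l < w !! l else w !! l < v !! l"
    using assms(2) by (auto simp: altlex_def)
  have "\<forall>i<min k l. u !! i = w !! i"
    using k(1) l(1) by simp
  moreover have "if even (min k l) then u !! min k l < w !! min k l
      else w !! min k l < u !! min k l"
    proof (cases k l rule: linorder_cases)
    case less
    then show ?thesis using k(2) l(1) by (auto simp: min_def split: if_splits)
  next
    case equal
    then show ?thesis using k(2) l(2) by (auto simp: min_def split: if_splits)
  next
    case greater
    then show ?thesis using k(1) l(2) by (auto simp: min_def split: if_splits)
  qed
  ultimately show ?thesis
    unfolding altlex_def by blast
qed

lemma altlex_total:
  assumes "v \<noteq> w"
  shows "altlex v w \<or> altlex w v"
proof -
  have "\<exists>k. v !! k \<noteq> w !! k"
    using assms by (metis ext stream_smap_nats)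
  then obtain k where k: "v !! k \<noteq> w !! k" "\<forall>i<k. v !! i = w !! i"
    using exists_least_iff[of "\<lambda>k. v !! k \<noteq> w !! k"] by auto
  then show ?thesis
    unfolding altlex_def by (metis nat_neq_iff)
qed

lemma altlex_min_eqI:
  assumes "v \<in> S" "\<And>w. w \<in> S \<Longrightarrow> v = w \<or> altlex v w"
  shows "altlex_min S = v"
  unfolding altlex_min_def
  proof (rule the_equality)
  show "v \<in> S \<and> (\<forall>w\<in>S. v = w \<or> altlex v w)"
    using assms by blast
next
  fix u assume "u \<in> S \<and> (\<forall>w\<in>S. u = w \<or> altlex u w)"
  then show "u = v"
    using assms altlex_trans[of u v u] altlex_irrefl[of u] by metis
qed

lemma altlex_min_least:
  assumes "finite S" "S \<noteq> {}"
  shows "altlex_min S \<in> S \<and> (\<forall>w\<in>S. altlex_min S = w \<or> altlex (altlex_min S) w)"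
proof -
  have "\<exists>v\<in>S. \<forall>w\<in>S. v = w \<or> altlex v w"
    using assms
  proof (induction rule: finite_ne_induct)
    case (insert x F)
    then obtain v where v: "v \<in> F" "\<forall>w\<in>F. v = w \<or> altlex v w" by blast
    then show ?case
      proof (cases "altlex x v")
      case True
      then have "\<forall>w\<in>insert x F. x = w \<or> altlex x w"
        using v(2) True altlex_trans[of x v] by auto
      then show ?thesis by blast
    next
      case False
      then have "\<forall>w\<in>insert x F. v = w \<or> altlex v w"
        using v(2) False altlex_total[of v x] by blast
      then show ?thesis using v(1) by blast
    qed
  qed simp
  then show ?thesis
    using altlex_min_eqI by metis
qed

section \<open>Sequences attached to a permutation\<close>

definition pos_max :: "nat \<Rightarrow> (nat \<Rightarrow> nat) \<Rightarrow> nat" where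
  "pos_max n \<pi> = inv \<pi> n"

text \<open>
  The positions \<open>\<ell>\<close> and \<open>r\<close> of the neighbours of \<open>\<pi> n\<close> are meaningful only if \<open>\<pi> n \<noteq> 1\<close>
  and \<open>\<pi> n \<noteq> n\<close>, respectively; they are not used otherwise.
\<close>

definition pos_left :: "nat \<Rightarrow> (nat \<Rightarrow> nat) \<Rightarrow> nat" where
  "pos_left n \<pi> = inv \<pi> (\<pi> n - 1)"

definition pos_right :: "nat \<Rightarrow> (nat \<Rightarrow> nat) \<Rightarrow> nat" where
  "pos_right n \<pi> = inv \<pi> (\<pi> n + 1)"

definition z :: "nat \<Rightarrow> (nat \<Rightarrow> nat) \<Rightarrow> nat \<Rightarrow> nat" where
  "z n \<pi> j =
     card {i. 1 \<le> i \<and> i < \<pi> j \<and>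
       (i \<noteq> \<pi> n \<and> \<pi> n \<noteq> i + 1 \<and> \<pi> (inv \<pi> i + 1) < \<pi> (inv \<pi> (i + 1) + 1) \<or>
        i + 1 = \<pi> n \<and> \<pi> n \<noteq> n \<and> \<pi> (pos_left n \<pi> + 1) < \<pi> (pos_right n \<pi> + 1))}"

definition subword :: "(nat \<Rightarrow> nat) \<Rightarrow> nat \<Rightarrow> nat \<Rightarrow> nat list" where
  "subword w i j = map w [i..<j]"

definition collapsed :: "nat \<Rightarrow> (nat \<Rightarrow> nat) \<Rightarrow> bool" where
  "collapsed n \<pi> \<longleftrightarrow>
     \<pi> n \<notin> {1, n} \<and>
     (let zl = subword (z n \<pi>) (pos_left n \<pi>) n;
          zr = subword (z n \<pi>) (pos_right n \<pi>) n
      in zl = zr @ zr \<or> zr = zl @ zl)"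

definition z_alt :: "nat \<Rightarrow> (nat \<Rightarrow> nat) \<Rightarrow> nat \<Rightarrow> nat \<Rightarrow> nat" where
  "z_alt n \<pi> i j =
     (if even i \<and> \<pi> j \<ge> \<pi> (pos_right n \<pi> + i) \<or> odd i \<and> \<pi> j \<ge> \<pi> (pos_left n \<pi> + i)
      then z n \<pi> j + 1 else z n \<pi> j)"

definition gap_indices :: "nat \<Rightarrow> (nat \<Rightarrow> nat) \<Rightarrow> nat set" where
  "gap_indices n \<pi> = {i. int i < \<bar>int (pos_right n \<pi>) - int (pos_left n \<pi>)\<bar>}"

definition a_seq :: "nat \<Rightarrow> (nat \<Rightarrow> nat) \<Rightarrow> nat stream" where
  "a_seq n \<pi> =
     (let m = pos_max n \<pi>; l = pos_left n \<pi>; r = pos_right n \<pi> in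
      if even (n - m) then
        if \<pi> n = 1 then cycle (subword (z n \<pi>) m n @ [0])
        else if collapsed n \<pi> then
          altlex_min ((\<lambda>i. subword (z_alt n \<pi> i) m n @- cycle (subword (z_alt n \<pi> i) l n))
            ` gap_indices n \<pi>)
        else subword (z n \<pi>) m n @- cycle (subword (z n \<pi>) l n)
      else
        if collapsed n \<pi> then
          altlex_min ((\<lambda>i. subword (z_alt n \<pi> i) m n @- cycle (subword (z_alt n \<pi> i) r n))
            ` gap_indices n \<pi>)
        else subword (z n \<pi>) m n @- cycle (subword (z n \<pi>) r n))"

section \<open>The substitution\<close>

text \<open>
  The substitution acts on words over \<open>{0, 1}\<close>; its value on other letters is irrelevant, as
  only iterates starting from the word \<open>[0]\<close> occur.
\<close>

definition phi :: "nat list \<Rightarrow> nat list" where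
  "phi w = concat (map (\<lambda>c. if c = 0 then [1] else [1, 0, 0]) w)"

end

theory Submission
  imports Defs
begin

text \<open>
  A realisation of \<open>\<pi>\<close> by \<open>neg_beta \<beta>\<close> has digits that exceed the minimal
  digits \<open>z\<close> only by additional jumps, and this forces \<open>a\<close> to be at most the expansion of \<open>1\<close>.
  Conversely, if \<open>a\<close> is smaller than the expansion of \<open>1\<close>, then the eventually periodic itineraries
  that end in the itinerary of a neighbour of \<open>\<pi> n\<close> are attained by points of \<open>(0, 1)\<close>, and moving
  the last point slightly to the correct side of its neighbour makes the order strict.
  As \<open>\<beta>\<close> decreases to \<open>1\<close>, renormalisation (the first return map to the right branch has again two
  decreasing branches, coded by \<open>phi\<close>) shows that the expansion of \<open>1\<close> converges to the fixed point
  \<open>omega\<close> of the substitution.  Finally, a shift-maximal sequence \<open>a \<le> omega\<close> with finitely many shifts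
  desubstitutes to another such sequence with fewer shifts unless it is constant, so
  that it is \<open>phi\<^sup>k(0)\<close> repeated.
\<close>

section \<open>Substitution and shift-maximal sequences\<close>

text \<open>A realisation yields only a weak bound on \<open>a\<close>, whereas constructing one
  needs a strict bound. In the limit the gap closes: every candidate allowed by the weak bound is
  some \<open>cycle ((phi ^^ k) [0])\<close>, and all of these lie strictly below
  \<open>omega\<close>. For \<beta> < 2 the only digits are 0 and 1. So if \<open>z\<close> is not
  identically 0, a realisation has no room for additional jumps and its digits are \<open>z\<close>.
  If \<open>z\<close> vanishes, \<open>a\<close> is constant unless the pattern is collapsed, and
  then the digits are those of \<open>z_alt\<close> with index 0. The obstacle in the construction
  is ties: different positions may share an itinerary and hence a point. Moving the last point
  displaces all tied positions with alternating signs and different sizes. The order comes out right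
  if every position tied with the chosen neighbour lies on the same side of position n as that
  neighbour. This can fail only if both neighbours have the same itinerary, which leads to collapsed
  patterns; the extra jump of \<open>z_alt\<close> then separates them.\<close>

lemma stream_eqI: "(\<And>i. s !! i = t !! i) \<Longrightarrow> s = t"
  by (metis ext stream_smap_nats)

text \<open>Removing the head shifts every index by one, which exchanges even and odd and so
  reverses the order of the tails.\<close>

lemma altlex_Stream: "altlex (a ## v) (b ## w) \<longleftrightarrow> a < b \<or> a = b \<and> altlex w v"
proof
  assume "altlex (a ## v) (b ## w)"
  then obtain k where k: "\<forall>i<k. (a ## v) !! i = (b ## w) !! i"
      "if even k then (a ## v) !! k < (b ## w) !! k else (b ## w) !! k < (a ## v) !! k"
    unfolding altlex_def by blast
  show "a < b \<or> a = b \<and> altlex w v"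
  proof (cases k)
    case 0
    then show ?thesis using k by simp
  next
    case (Suc k')
    have "a = b" using k(1) Suc by force
    moreover have "\<forall>i<k'. w !! i = v !! i" using k(1) Suc by force
    moreover have "if even k' then w !! k' < v !! k' else v !! k' < w !! k'"
      using k(2) Suc by (simp split: if_splits)
    ultimately show ?thesis unfolding altlex_def by blast
  qed
next
  assume "a < b \<or> a = b \<and> altlex w v"
  then show "altlex (a ## v) (b ## w)"
  proof
    assume "a < b"
    then show ?thesis unfolding altlex_def by (intro exI[of _ 0]) simp
  next
    assume *: "a = b \<and> altlex w v"
    then obtain k where k: "\<forall>i<k. w !! i = v !! i"
        "if even k then w !! k < v !! k else v !! k < w !! k"
      unfolding altlex_def by blast
    have "(a ## v) !! i = (b ## w) !! i" if "i < Suc k" for i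
      using that k(1) * by (cases i) auto
    then show ?thesis unfolding altlex_def using k(2)
      by (intro exI[of _ "Suc k"]) (auto split: if_splits)
  qed
qed

lemma altlex_shift:
  "altlex (u @- v) (u @- w) \<longleftrightarrow> (if even (length u) then altlex v w else altlex w v)"
  by (induction u arbitrary: v w) (auto simp: altlex_Stream)

text \<open>By totality, \<open>\<not> altlex v u\<close> means that u is at most v; the weak order
  is written in this form throughout.\<close>

lemma altle_trans: "\<not> altlex v u \<Longrightarrow> \<not> altlex w v \<Longrightarrow> \<not> altlex w u"
  by (metis altlex_total altlex_trans)

lemma altle_less_trans: "\<not> altlex v u \<Longrightarrow> altlex v w \<Longrightarrow> altlex u w"
  by (metis altlex_total altlex_trans)

lemma cycle_unique:
  assumes "v \<noteq> []" "x = v @- x"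
  shows "x = cycle v"
proof (rule stream_eqI)
  fix i
  show "x !! i = cycle v !! i"
  proof (induction i rule: less_induct)
    case (less i)
    have "x !! i = (if i < length v then v ! i else x !! (i - length v))"
      using shift_snth[of v x i] assms(2) by (metis not_le shift_snth_ge shift_snth_less)
    moreover have "cycle v !! i = (if i < length v then v ! i else cycle v !! (i - length v))"
      using cycle_decomp[OF assms(1)] by (metis not_le shift_snth_ge shift_snth_less)
    moreover have "i - length v < i" if "\<not> i < length v"
      using that assms(1) by (cases v) auto
    ultimately show ?case using less by auto
  qed
qed

lemma constant_stream:
  assumes "\<And>i. a !! i = c"
  shows "a = cycle [c]"
proof (rule cycle_unique)
  show "a = [c] @- a"
  proof (rule stream_eqI)
    fix i
    show "a !! i = ([c] @- a) !! i"
      using assms[of i] assms[of "i - 1"] by (cases i) simp_all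
  qed
qed simp

text \<open>Prepending the nonempty \<open>q\<close> prolongs the agreement with
  \<open>cycle q\<close> by at least one letter, so the range \<open>i \<le> k\<close> includes the
  place where \<open>u\<close> itself may deviate.\<close>

lemma shift_cycle_agree:
  assumes "q \<noteq> []" "\<forall>i<k. u !! i = cycle q !! i" "i \<le> k"
  shows "(q @- u) !! i = cycle q !! i"
proof (cases "i < length q")
  case True
  then show ?thesis using cycle_decomp[OF assms(1)] by (metis shift_snth_less)
next
  case False
  then have "(q @- u) !! i = u !! (i - length q)" by (simp add: shift_snth_ge)
  also have "\<dots> = cycle q !! (i - length q)"
    using assms False by (metis diff_less length_greater_0_conv less_le_trans not_less order_less_le_trans)
  also have "\<dots> = cycle q !! i"
    using cycle_decomp[OF assms(1)] False by (metis not_less shift_snth_ge)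
  finally show ?thesis .
qed

text \<open>The first deviation of \<open>u\<close> from \<open>cycle q\<close> is also its first
  deviation from \<open>q @- u\<close>. Read contrapositively, this and the next lemma turn the
  comparison of an orbit point with its neighbour into one with a periodic itinerary.\<close>

lemma altlex_cycle_right:
  assumes "q \<noteq> []" "altlex u (cycle q)"
  shows "altlex u (q @- u)"
proof -
  obtain k where k: "\<forall>i<k. u !! i = cycle q !! i"
      "if even k then u !! k < cycle q !! k else cycle q !! k < u !! k"
    using assms(2) unfolding altlex_def by blast
  then show ?thesis
    unfolding altlex_def using shift_cycle_agree[OF assms(1) k(1)] by (intro exI[of _ k]) simp
qed

lemma altlex_cycle_left:
  assumes "q \<noteq> []" "altlex (cycle q) u"
  shows "altlex (q @- u) u"
proof -
  obtain k where k: "\<forall>i<k. cycle q !! i = u !! i"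
      "if even k then cycle q !! k < u !! k else u !! k < cycle q !! k"
    using assms(2) unfolding altlex_def by blast
  then show ?thesis
    unfolding altlex_def using shift_cycle_agree[OF assms(1), of k u] by (intro exI[of _ k]) simp
qed

section \<open>The substitution on infinite sequences\<close>

definition letter :: "nat \<Rightarrow> nat list" where
  "letter c = (if c = 0 then [1] else [1, 0, 0])"

definition Phi :: "nat stream \<Rightarrow> nat stream" where
  "Phi s = flat (smap letter s)"

lemma phi_eq_concat: "phi w = concat (map letter w)"
  by (simp add: phi_def letter_def[abs_def])

lemma phi_append: "phi (u @ v) = phi u @ phi v"
  by (simp add: phi_eq_concat)

lemma phi_pow_append: "(phi ^^ k) (u @ v) = (phi ^^ k) u @ (phi ^^ k) v"
  by (induction k) (simp_all add: phi_append)

lemma phi_pow_Suc_0: "(phi ^^ Suc k) [0] = (phi ^^ k) [1]"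
  by (simp add: funpow_swap1 phi_def del: funpow.simps) (simp add: phi_def funpow_swap1)

text \<open>Expanding the innermost letter shows that each word is a prefix of the next; the same
  three blocks make up the longer return time in the renormalisation.\<close>

lemma phi_pow_Suc_1: "(phi ^^ Suc k) [1] = (phi ^^ k) [1] @ (phi ^^ k) [0] @ (phi ^^ k) [0]"
proof -
  have "(phi ^^ Suc k) [1] = (phi ^^ k) ([1] @ [0] @ [0])"
    by (simp only: funpow_Suc_right comp_def) (simp add: phi_def)
  then show ?thesis by (simp only: phi_pow_append)
qed

lemma Phi_Stream: "Phi (c ## s) = letter c @- Phi s"
  by (simp add: Phi_def letter_def)

lemma shd_Phi: "shd (Phi s) = 1"
  by (cases s) (simp add: Phi_Stream letter_def)

lemma Phi_shift: "Phi (w @- s) = phi w @- Phi s"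
  by (induction w) (simp_all add: Phi_Stream phi_eq_concat)

lemma phi_eq_Nil_iff [simp]: "phi w = [] \<longleftrightarrow> w = []"
  by (cases w) (auto simp: phi_def)

lemma Phi_cycle: "w \<noteq> [] \<Longrightarrow> Phi (cycle w) = cycle (phi w)"
  by (rule cycle_unique) (simp, metis Phi_shift cycle_decomp)

text \<open>Both images 1 and 100 have odd length, so the image of a common prefix has a length of
  the same parity. At the first difference, 0 becomes 1 followed by the initial 1 of the next image,
  while 1 becomes 100; as 11 is below 10, the order survives.\<close>

lemma Phi_altlex:
  assumes "sset s \<subseteq> {0, 1}" "sset t \<subseteq> {0, 1}" "altlex s t"
  shows "altlex (Phi s) (Phi t)"
proof -
  obtain k where "\<forall>i<k. s !! i = t !! i" "if even k then s !! k < t !! k else t !! k < s !! k"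
    using assms(3) unfolding altlex_def by blast
  then show ?thesis
    using assms(1,2)
  proof (induction k arbitrary: s t)
    case 0
    obtain a s' b t' where [simp]: "s = a ## s'" "t = b ## t'"
      by (metis stream.exhaust_sel)
    from 0 have ab: "a = 0" "b = 1" by auto
    obtain u where "Phi s' = 1 ## u" by (metis shd_Phi stream.exhaust_sel)
    then show ?case by (simp add: ab Phi_Stream letter_def altlex_Stream)
  next
    case (Suc k)
    obtain a s' b t' where st: "s = a ## s'" "t = b ## t'"
      by (metis stream.exhaust_sel)
    have "a = b" using Suc.prems(1) st by force
    have "altlex (Phi t') (Phi s')"
    proof (rule Suc.IH)
      show "\<forall>i<k. t' !! i = s' !! i" using Suc.prems(1) st by force
      show "if even k then t' !! k < s' !! k else s' !! k < t' !! k"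
        using Suc.prems(2) st by (auto split: if_splits)
    qed (use Suc.prems st in auto)
    then show ?case using \<open>a = b\<close> st
      by (simp add: Phi_Stream altlex_shift letter_def altlex_Stream)
  qed
qed

lemma Phi_altle:
  assumes "sset s \<subseteq> {0, 1}" "sset t \<subseteq> {0, 1}" "\<not> altlex (Phi s) (Phi t)"
  shows "\<not> altlex s t"
  using Phi_altlex assms by blast

lemma Phi_inj:
  assumes "sset s \<subseteq> {0, 1}" "sset t \<subseteq> {0, 1}" "Phi s = Phi t"
  shows "s = t"
  using Phi_altlex assms altlex_total altlex_irrefl by metis

section \<open>The fixed point of the substitution\<close>

definition omega :: "nat stream" where
  "omega = smap (\<lambda>i. (phi ^^ i) [1] ! i) nats"

text \<open>This justifies the diagonal in \<open>omega\<close>: the i-th word has a letter at index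
  i, and later words extend it.\<close>

lemma length_phi_pow_1: "k < length ((phi ^^ k) [1])"
proof (induction k)
  case (Suc k)
  have "(phi ^^ k) [0] \<noteq> []" by (induction k) auto
  then have "length ((phi ^^ k) [0]) \<ge> 1" by (simp add: Suc_leI)
  then show ?case using Suc unfolding phi_pow_Suc_1 by simp
qed simp

lemma phi_pow_1_prefix:
  assumes "k \<le> k'" "i < length ((phi ^^ k) [1])"
  shows "i < length ((phi ^^ k') [1]) \<and> (phi ^^ k') [1] ! i = (phi ^^ k) [1] ! i"
  using assms(1)
proof (induction rule: dec_induct)
  case (step j)
  then show ?case unfolding phi_pow_Suc_1 by (simp add: nth_append)
qed (use assms in simp)

lemma omega_nth:
  assumes "i < length ((phi ^^ k) [1])"
  shows "omega !! i = (phi ^^ k) [1] ! i"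
  using phi_pow_1_prefix[OF _ assms, of i] phi_pow_1_prefix[OF _ length_phi_pow_1, of i k]
  by (cases "k \<le> i") (auto simp: omega_def)

lemma sset_phi_pow: "set w \<subseteq> {0, 1} \<Longrightarrow> set ((phi ^^ k) w) \<subseteq> {0, 1}"
  by (induction k) (auto simp: phi_def)

lemma sset_omega: "sset omega \<subseteq> {0, 1}"
proof
  fix x assume "x \<in> sset omega"
  then obtain i where "x = omega !! i" by (metis imageE sset_range)
  then have "x \<in> set ((phi ^^ i) [1])"
    using omega_nth[OF length_phi_pow_1] length_phi_pow_1 by simp
  then show "x \<in> {0, 1}" using sset_phi_pow[of "[1]" i] by auto
qed

lemma omega_shift: "omega = (phi ^^ k) [1] @- sdrop (length ((phi ^^ k) [1])) omega"
proof -
  have "stake (length ((phi ^^ k) [1])) omega = (phi ^^ k) [1]"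
    by (rule nth_equalityI) (simp_all add: omega_nth)
  then show ?thesis by (metis stake_sdrop)
qed

lemma Phi_omega: "Phi omega = omega"
proof (rule stream_eqI)
  fix i
  have "Phi omega = (phi ^^ Suc i) [1] @- Phi (sdrop (length ((phi ^^ i) [1])) omega)"
    by (subst omega_shift[of i]) (simp add: Phi_shift)
  moreover have "i < length ((phi ^^ Suc i) [1])"
    using length_phi_pow_1[of "Suc i"] by linarith
  ultimately show "Phi omega !! i = omega !! i"
    using omega_nth by (metis shift_snth_less)
qed

lemma shd_omega: "shd omega = 1"
  using Phi_omega shd_Phi by metis

lemma phi_pow_0_neq_Nil: "(phi ^^ k) [0] \<noteq> []"
  by (induction k) auto

lemma sset_cycle_subset:
  assumes "w \<noteq> []"
  shows "sset (cycle w) \<subseteq> set w"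
proof -
  have "cycle w !! i \<in> set w" for i
  proof (induction i rule: less_induct)
    case (less i)
    show ?case
    proof (cases "i < length w")
      case True
      then show ?thesis using cycle_decomp[OF assms] by (metis nth_mem shift_snth_less)
    next
      case False
      then have "cycle w !! i = cycle w !! (i - length w)"
        using cycle_decomp[OF assms] by (metis not_less shift_snth_ge)
      then show ?thesis using less[of "i - length w"] False assms by (cases w) auto
    qed
  qed
  then show ?thesis by (auto simp: sset_range)
qed

text \<open>The zero sequence is below \<open>omega\<close>, which begins with 1; \<open>Phi\<close>
  preserves strict order and fixes \<open>omega\<close>, so this propagates to all k. The strictness
  is the room needed for realisations.\<close>

lemma cycle_phi_less_omega: "altlex (cycle ((phi ^^ k) [0])) omega"
proof (induction k)
  case 0
  have "cycle [0] = 0 ## cycle [0 :: nat]" "omega = 1 ## stl omega"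
    using cycle_decomp[of "[0::nat]"] shd_omega by (auto, metis stream.collapse)
  then show ?case by (metis altlex_Stream funpow_0 zero_less_one)
next
  case (Suc k)
  have "sset (cycle ((phi ^^ k) [0])) \<subseteq> {0, 1}"
    using sset_cycle_subset[OF phi_pow_0_neq_Nil] sset_phi_pow[of "[0]" k] by auto
  then show ?case
    using Phi_altlex[OF _ sset_omega Suc] Phi_omega Phi_cycle[OF phi_pow_0_neq_Nil] by simp
qed

section \<open>Desubstitution\<close>

definition parse_step :: "nat stream \<Rightarrow> nat stream" where
  "parse_step s = (if s !! 1 = 1 then stl s else sdrop 3 s)"

definition parse :: "nat stream \<Rightarrow> nat stream" where
  "parse s = smap (\<lambda>t. if t !! 1 = 1 then 0 else 1) (siterate parse_step s)"

lemma parse_Stream: "parse s = (if s !! 1 = 1 then 0 else 1) ## parse (parse_step s)"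
  unfolding parse_def by (subst siterate.code) simp

text \<open>These are the infinite concatenations of the blocks 1 and 100, expressed locally so that
  the condition can be checked at each 1 separately.\<close>

definition parsable :: "nat stream \<Rightarrow> bool" where
  "parsable s \<longleftrightarrow> shd s = 1 \<and>
     (\<forall>i. s !! i = 1 \<longrightarrow> s !! (i + 1) = 1 \<or> s !! (i + 1) = 0 \<and> s !! (i + 2) = 0 \<and> s !! (i + 3) = 1)"

lemma parsable_step:
  assumes "parsable s"
  shows "parsable (parse_step s)" "s = letter (if s !! 1 = 1 then 0 else 1) @- parse_step s"
proof -
  have h: "s !! (i + 1) = 1 \<or> s !! (i + 1) = 0 \<and> s !! (i + 2) = 0 \<and> s !! (i + 3) = 1" if "s !! i = 1" for i
    using assms that unfolding parsable_def by blast
  have shd: "s !! 0 = 1" using assms by (simp add: parsable_def)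
  have dec: "s = s !! 0 ## stl s" "s = s !! 0 ## s !! 1 ## s !! 2 ## sdrop 3 s"
    by (simp_all add: numeral_2_eq_2 numeral_3_eq_3)
  have nth: "stl s !! i = s !! Suc i" "sdrop 3 s !! i = s !! (i + 3)" for i
    by (simp_all add: sdrop_snth add.commute)
  show "s = letter (if s !! 1 = 1 then 0 else 1) @- parse_step s"
  proof (cases "s !! 1 = 1")
    case True
    have "s = 1 ## stl s" using shd by (metis snth.simps(1) stream.collapse)
    then show ?thesis using True by (simp add: parse_step_def letter_def)
  next
    case False
    then have "s = 1 ## 0 ## 0 ## sdrop 3 s" using dec(2) h[of 0] shd by (metis add_0)
    then show ?thesis using False by (simp add: parse_step_def letter_def)
  qed
  show "parsable (parse_step s)"
  proof (cases "s !! 1 = 1")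
    case True
    have "stl s !! i = 1 \<Longrightarrow> stl s !! (i + 1) = 1 \<or> stl s !! (i + 1) = 0 \<and> stl s !! (i + 2) = 0 \<and> stl s !! (i + 3) = 1" for i
      using h[of "Suc i"] unfolding nth by simp
    then show ?thesis using True unfolding parsable_def parse_step_def by simp
  next
    case False
    have "sdrop 3 s !! i = 1 \<Longrightarrow> sdrop 3 s !! (i + 1) = 1 \<or> sdrop 3 s !! (i + 1) = 0 \<and> sdrop 3 s !! (i + 2) = 0 \<and> sdrop 3 s !! (i + 3) = 1" for i
      using h[of "i + 3"] unfolding nth by (simp add: algebra_simps)
    moreover have "sdrop 3 s !! 0 = 1" using h[of 0] shd False unfolding nth by simp
    ultimately show ?thesis using False unfolding parsable_def parse_step_def by (simp)
  qed
qed

lemma Phi_parse: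
  assumes "parsable s"
  shows "Phi (parse s) = s"
proof (rule stream_eqI)
  fix i
  show "Phi (parse s) !! i = s !! i"
    using assms
  proof (induction i arbitrary: s rule: less_induct)
    case (less i)
    let ?c = "if s !! 1 = 1 then 0 else 1 :: nat"
    have 1: "Phi (parse s) = letter ?c @- Phi (parse (parse_step s))"
      by (subst parse_Stream) (simp add: Phi_Stream)
    note 2 = parsable_step[OF less.prems]
    show ?case
    proof (cases "i < length (letter ?c)")
      case True
      then show ?thesis using 1 2(2) by (metis shift_snth_less)
    next
      case False
      have "Phi (parse (parse_step s)) !! (i - length (letter ?c)) = parse_step s !! (i - length (letter ?c))"
        by (rule less.IH[OF _ 2(1)]) (use False in \<open>auto simp: letter_def split: if_splits\<close>)
      then show ?thesis using 1 2(2) False by (metis not_less shift_snth_ge)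
    qed
  qed
qed

lemma sset_parse: "sset (parse s) \<subseteq> {0, 1}"
  by (auto simp: parse_def stream.set_map)

text \<open>Shifts of \<open>s\<close> become shifts of \<open>Phi s\<close> at block boundaries.
  Hence shift-maximality and finiteness of the set of shifts pass from the image back to
  \<open>s\<close>.\<close>

lemma sdrop_Phi: "\<exists>j. Phi (sdrop i s) = sdrop j (Phi s)"
proof -
  have "Phi s = phi (stake i s) @- Phi (sdrop i s)" by (metis Phi_shift stake_sdrop)
  then have "Phi (sdrop i s) = sdrop (length (phi (stake i s))) (Phi s)"
    by (metis diff_self_eq_0 dual_order.refl sdrop.simps(1) sdrop_shift append_Nil drop_all shift.simps(1))
  then show ?thesis by blast
qed

lemma sset_sdrop: "sset (sdrop i s) \<subseteq> sset s"
  by (metis Un_upper2 sset_shift stake_sdrop)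

text \<open>The words 101 and 1000 exceed 1001 in the alternating order, so under this bound a
  sequence starting with 1 starts with 11 or 1001; this is the block rule of
  \<open>parsable\<close>.\<close>

lemma le_1001_cases:
  assumes "\<not> altlex (1 ## 0 ## 0 ## 1 ## v) t" "sset t \<subseteq> {0, 1}" "t !! 0 = 1"
  shows "t !! 1 = 1 \<or> t !! 1 = 0 \<and> t !! 2 = 0 \<and> t !! 3 = 1"
proof -
  have t: "t = t !! 0 ## t !! 1 ## t !! 2 ## t !! 3 ## sdrop 4 t"
    by (simp add: numeral_2_eq_2 numeral_3_eq_3 numeral_eq_Suc)
  have "t !! i \<in> {0, 1}" for i using assms(2) by (metis snth_sset subsetD)
  then have "t !! 1 \<in> {0, 1}" "t !! 2 \<in> {0, 1}" "t !! 3 \<in> {0, 1}" by blast+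
  moreover have "\<not> altlex (1 ## 0 ## 0 ## 1 ## v) (t !! 0 ## t !! 1 ## t !! 2 ## t !! 3 ## sdrop 4 t)"
    using assms(1) t by metis
  ultimately show ?thesis unfolding altlex_Stream using assms(3) by auto
qed

lemma omega_1001: "\<exists>v. omega = 1 ## 0 ## 0 ## 1 ## v"
proof -
  obtain u where u: "omega = 1 ## u" by (metis shd_omega stream.collapse)
  obtain v where v: "Phi u = 1 ## v" by (metis shd_Phi stream.collapse)
  have "omega = Phi (1 ## u)" using Phi_omega u by metis
  then show ?thesis unfolding Phi_Stream letter_def v by auto
qed

theorem shift_maximal_le_omega:
  assumes "sset a \<subseteq> {0, 1}" "\<And>i. \<not> altlex a (sdrop i a)" "\<not> altlex omega a"
    "finite (range (\<lambda>i. sdrop i a))"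
  shows "\<exists>k. a = cycle ((phi ^^ k) [0])"
  using assms
proof (induction "card (range (\<lambda>i. sdrop i a))" arbitrary: a rule: less_induct)
  case less
  have dig: "a !! i \<in> {0, 1}" for i using less.prems(1) by (auto simp: sset_range)
  have shd_sdrop: "sdrop i a = a !! i ## sdrop (Suc i) a" for i by (metis sdrop_simps id_apply stream.collapse)
  consider (zero) "a !! 0 = 0" | (one) "\<And>i. a !! i = 1" | (mixed) i where "a !! 0 = 1" "a !! i = 0"
  proof (cases "a !! 0 = 0 \<or> (\<forall>i. a !! i = 1)")
    case False
    then obtain i where "a !! i \<noteq> 1" by blast
    then show ?thesis using that(3)[of i] False dig[of i] dig[of 0] by auto
  qed (use that in blast)
  then show ?case
  proof cases
    case zero
    have "a !! i = 0" for i
    proof -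
      have "\<not> altlex (a !! 0 ## sdrop 1 a) (a !! i ## sdrop (Suc i) a)"
        using less.prems(2)[of i] shd_sdrop[of 0] shd_sdrop[of i] by simp
      then show ?thesis using zero unfolding altlex_Stream by simp
    qed
    then have "a = cycle [0]" by (rule constant_stream)
    then show ?thesis by (intro exI[of _ 0]) simp
  next
    case one
    then have "a = cycle [1]" by (rule constant_stream)
    then show ?thesis by (intro exI[of _ 1]) (simp add: phi_def)
  next
    case mixed
    obtain v where v: "omega = 1 ## 0 ## 0 ## 1 ## v" using omega_1001 by blast
    have "parsable a"
      unfolding parsable_def
    proof (intro conjI allI impI)
      show "shd a = 1" using mixed by simp
      fix i assume i: "a !! i = 1"
      \<comment> \<open>Shift-maximality extends the bound from \<open>a\<close> to all its shifts,
        so the block rule holds at every 1.\<close>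
      have "\<not> altlex omega (sdrop i a)" using altle_trans less.prems(2,3) by blast
      then have "sdrop i a !! 1 = 1 \<or> sdrop i a !! 1 = 0 \<and> sdrop i a !! 2 = 0 \<and> sdrop i a !! 3 = 1"
        unfolding v 
        by (rule le_1001_cases) (use i order_trans[OF sset_sdrop less.prems(1)] in \<open>simp_all add: sdrop_snth\<close>)
      then show "a !! (i + 1) = 1 \<or> a !! (i + 1) = 0 \<and> a !! (i + 2) = 0 \<and> a !! (i + 3) = 1"
        by (simp only: sdrop_snth)
    qed
    define b where "b = parse a"
    have ab: "Phi b = a" using Phi_parse[OF \<open>parsable a\<close>] b_def by simp
    have b01: "sset b \<subseteq> {0, 1}" using sset_parse b_def by simp
    have b01': "sset (sdrop i b) \<subseteq> {0, 1}" for i by (rule order_trans[OF sset_sdrop b01])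
    have max: "\<not> altlex b (sdrop i b)" for i
      by (rule Phi_altle[OF b01 b01']) (metis ab sdrop_Phi less.prems(2))
    have le: "\<not> altlex omega b"
      by (rule Phi_altle[OF sset_omega b01]) (simp add: ab Phi_omega less.prems(3))
    have inj: "inj_on Phi (range (\<lambda>i. sdrop i b))"
      using Phi_inj[OF b01' b01'] by (auto simp: inj_on_def)
    have sub: "Phi ` range (\<lambda>i. sdrop i b) \<subseteq> range (\<lambda>i. sdrop i a)"
    proof (rule subsetI)
      fix x assume "x \<in> Phi ` range (\<lambda>i. sdrop i b)"
      then obtain i where "x = Phi (sdrop i b)" by (elim imageE) simp
      then show "x \<in> range (\<lambda>i. sdrop i a)" using sdrop_Phi[of i b] ab by auto
    qed
    \<comment> \<open>Images under \<open>Phi\<close> start with 1, so the shift at a 0 is lost;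
      this makes the number of shifts decrease.\<close>
    have "sdrop i a \<notin> Phi ` range (\<lambda>i. sdrop i b)"
    proof
      assume "sdrop i a \<in> Phi ` range (\<lambda>i. sdrop i b)"
      then obtain j where "sdrop i a = Phi (sdrop j b)" by (elim imageE) simp
      then have "shd (sdrop i a) = 1" using shd_Phi by simp
      then show False using mixed by simp
    qed
    then have "Phi ` range (\<lambda>i. sdrop i b) \<subset> range (\<lambda>i. sdrop i a)" using sub by blast
    then have "card (Phi ` range (\<lambda>i. sdrop i b)) < card (range (\<lambda>i. sdrop i a))"
      by (rule psubset_card_mono[OF less.prems(4)])
    then have card: "card (range (\<lambda>i. sdrop i b)) < card (range (\<lambda>i. sdrop i a))"
      using card_image[OF inj] by simp
    have fin: "finite (range (\<lambda>i. sdrop i b))"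
      using finite_imageD[OF finite_subset[OF sub less.prems(4)] inj] .
    obtain k where "b = cycle ((phi ^^ k) [0])"
      using less.hyps[OF card b01 max le fin] by blast
    then have "a = cycle ((phi ^^ Suc k) [0])"
      using ab Phi_cycle[OF phi_pow_0_neq_Nil] by simp
    then show ?thesis by blast
  qed
qed

section \<open>The expansion of 1 near 1\<close>

text \<open>Composition of the affine branches prescribed by the word, whether or not its letters
  are the true digits; \<open>interior_orbit\<close> provides the link to the actual orbit.\<close>

primrec word_map :: "real \<Rightarrow> nat list \<Rightarrow> real \<Rightarrow> real" where
  "word_map \<beta> [] x = x"
| "word_map \<beta> (c # w) x = word_map \<beta> w (real c + 1 - \<beta> * x)"

lemma word_map_append: "word_map \<beta> (u @ v) x = word_map \<beta> v (word_map \<beta> u x)"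
  by (induction u arbitrary: x) simp_all

lemma word_map_diff:
  "word_map \<beta> w x - word_map \<beta> w y = (- \<beta>) ^ length w * (x - y)"
proof (induction w arbitrary: x y)
  case (Cons c w)
  show ?case unfolding word_map.simps Cons.IH by (simp add: algebra_simps)
qed simp

text \<open>Start and final value are left free: the start may be 1, and the final value is
  controlled separately by the values of the branches at their endpoints.\<close>

definition interior_orbit :: "real \<Rightarrow> nat list \<Rightarrow> real \<Rightarrow> bool" where
  "interior_orbit \<beta> w x \<longleftrightarrow>
     (\<forall>i. 0 < i \<and> i < length w \<longrightarrow> 0 < word_map \<beta> (take i w) x \<and> word_map \<beta> (take i w) x < 1)"

lemma interior_orbit_append:
  assumes "interior_orbit \<beta> u x" "0 < word_map \<beta> u x" "word_map \<beta> u x < 1"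
    "interior_orbit \<beta> v (word_map \<beta> u x)"
  shows "interior_orbit \<beta> (u @ v) x"
  unfolding interior_orbit_def
proof (intro allI impI)
  fix i assume i: "0 < i \<and> i < length (u @ v)"
  consider "i < length u" | "i = length u" | "length u < i" by linarith
  then show "0 < word_map \<beta> (take i (u @ v)) x \<and> word_map \<beta> (take i (u @ v)) x < 1"
  proof cases
    case 1
    then show ?thesis using assms(1) i unfolding interior_orbit_def by simp
  next
    case 2
    then show ?thesis using assms(2,3) by simp
  next
    case 3
    then have "0 < i - length u \<and> i - length u < length v" using i by auto
    then show ?thesis using assms(4) 3 unfolding interior_orbit_def by (simp add: word_map_append)
  qed
qed

text \<open>
  The \<open>k\<close>-th return map lives on \<open>(A, 1]\<close> and is discontinuous at \<open>c\<close>; its left branch is onto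
  \<open>(A, 1)\<close> and both branches start at height \<open>1\<close>.  The next return map lives on \<open>(c, 1]\<close>.
\<close>
definition renormalizable :: "real \<Rightarrow> nat \<Rightarrow> real \<Rightarrow> real \<Rightarrow> bool" where
  "renormalizable \<beta> k A c \<longleftrightarrow> 0 \<le> A \<and> A < c \<and> c < 1 \<and>
     word_map \<beta> ((phi ^^ k) [0]) A = 1 \<and> word_map \<beta> ((phi ^^ k) [0]) c = A \<and>
     word_map \<beta> ((phi ^^ k) [1]) c = 1 \<and> A < word_map \<beta> ((phi ^^ k) [1]) 1 \<and>
     (\<forall>x. A < x \<and> x < c \<longrightarrow> interior_orbit \<beta> ((phi ^^ k) [0]) x) \<and>
     (\<forall>x. c < x \<and> x \<le> 1 \<longrightarrow> interior_orbit \<beta> ((phi ^^ k) [1]) x)"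

text \<open>Hence both branches of the return map are decreasing at every level.\<close>

lemma odd_length_phi_pow: "odd (length ((phi ^^ k) [0])) \<and> odd (length ((phi ^^ k) [1]))"
proof (induction k)
  case (Suc k)
  then show ?case unfolding phi_pow_Suc_0 phi_pow_Suc_1 by simp
qed simp

lemma renormalizable_0:
  assumes "1 < \<beta>" "\<beta> < 2"
  shows "renormalizable \<beta> 0 0 (1 / \<beta>)"
  using assms by (simp add: renormalizable_def interior_orbit_def)

text \<open>Write u and v for the words of the left and right branch. A point of (c, 1] returns
  after v if it lies to the left of the preimage c' of c; otherwise v sends it to the left of c and
  two passes of u bring it back. The return words v and vuu are the words of the next level. The
  hypothesis \<open>small\<close> keeps the image of 1 above c.\<close>

lemma renormalizable_Suc:
  assumes "1 < \<beta>" "renormalizable \<beta> k A c"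
    and small: "\<beta> ^ (2 * length ((phi ^^ k) [0])) * (\<beta> ^ length ((phi ^^ k) [1]) - 1) < 1"
  shows "\<exists>c'. renormalizable \<beta> (Suc k) c c'"
proof -
  define u v where "u = (phi ^^ k) [0]" and "v = (phi ^^ k) [1]"
  define p q where "p = \<beta> ^ length u" and "q = \<beta> ^ length v"
  have odd: "odd (length u)" "odd (length v)" using odd_length_phi_pow u_def v_def by auto
  have p: "1 < p" and q: "1 < q"
    using odd assms(1) by (auto simp: p_def q_def intro!: one_less_power odd_pos)
  have Gu: "word_map \<beta> u x - word_map \<beta> u y = p * (y - x)" for x y
    using odd by (simp add: word_map_diff p_def algebra_simps)
  have Gv: "word_map \<beta> v x - word_map \<beta> v y = q * (y - x)" for x y
    using odd by (simp add: word_map_diff q_def algebra_simps)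
  have decu: "word_map \<beta> u y < word_map \<beta> u x" if "x < y" for x y
  proof -
    have "0 < p * (y - x)" using that p by simp
    then show ?thesis using Gu[of x y] by linarith
  qed
  have decv: "word_map \<beta> v y < word_map \<beta> v x" if "x < y" for x y
  proof -
    have "0 < q * (y - x)" using that q by simp
    then show ?thesis using Gv[of x y] by linarith
  qed
  have inv: "0 \<le> A" "A < c" "c < 1" "word_map \<beta> u A = 1" "word_map \<beta> u c = A"
    "word_map \<beta> v c = 1" "A < word_map \<beta> v 1"
    "\<And>x. A < x \<Longrightarrow> x < c \<Longrightarrow> interior_orbit \<beta> u x"
    "\<And>x. c < x \<Longrightarrow> x \<le> 1 \<Longrightarrow> interior_orbit \<beta> v x"
    using assms(2) unfolding renormalizable_def u_def v_def by auto
  \<comment> \<open>The solution of v(c') = c, since v has the value 1 at c and slope -q.\<close>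
  define c' where "c' = c + (1 - c) / q"
  have qc': "q * (c' - c) = 1 - c" using q by (simp add: c'_def)
  have "(1 - c) / q < 1 - c" using inv(3) q by (simp add: divide_less_eq)
  then have c': "c < c'" "c' < 1" using inv(3) q by (auto simp: c'_def)
  have vc': "word_map \<beta> v c' = c" using Gv[of c' c] qc' inv(6) by (simp add: algebra_simps)
  have small': "p * p * (q - 1) < 1"
    using small unfolding p_def q_def u_def v_def by (simp add: mult_2 power_add)
  define D where "D = word_map \<beta> v 1"
  define D' where "D' = word_map \<beta> u (word_map \<beta> u D)"
  have "c - D = q * (1 - c')" using Gv[of c' 1] vc' D_def by simp
  also have "\<dots> = q * ((1 - c) - (c' - c))" by simp
  also have "\<dots> = (q - 1) * (1 - c)" using qc' by (simp only: right_diff_distrib) (simp add: algebra_simps)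
  finally have cD: "c - D = (q - 1) * (1 - c)" .
  \<comment> \<open>Since u maps c to A and A to 1, two passes of u multiply the distance of D from
    c by p * p; by \<open>small\<close> the result is less than 1 - c.\<close>
  have "1 - D' = p * (word_map \<beta> u D - word_map \<beta> u c)"
    using Gu[of "word_map \<beta> u c" "word_map \<beta> u D"] inv(4,5) by (simp add: D'_def)
  also have "\<dots> = p * (p * (c - D))" using Gu[of D c] by simp
  also have "\<dots> = p * p * (q - 1) * (1 - c)" using cD by (simp add: mult.assoc)
  also have "\<dots> < 1 * (1 - c)" using small' inv(3) by (intro mult_strict_right_mono) auto
  finally have D': "c < D'" by simp
  have uD: "word_map \<beta> u D < c"
  proof (rule ccontr)
    assume "\<not> word_map \<beta> u D < c"
    then have "D' \<le> A" using decu[of c "word_map \<beta> u D"] inv(5) D'_def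
      by (cases "word_map \<beta> u D = c") auto
    then show False using D' inv(2) by simp
  qed
  have int1: "interior_orbit \<beta> v x" if "c < x" "x < c'" for x
    using inv(9) that c' by simp
  have int2: "interior_orbit \<beta> (v @ u @ u) x" if x: "c' < x" "x \<le> 1" for x
  proof -
    define x1 where "x1 = word_map \<beta> v x"
    define x2 where "x2 = word_map \<beta> u x1"
    have "D \<le> x1" using decv[of x 1] x unfolding x1_def D_def by (cases "x = 1") auto
    moreover have "x1 < c" using decv[of c' x] x vc' x1_def by simp
    ultimately have x1: "A < x1" "x1 < c" "D \<le> x1" using inv(7) D_def by auto
    have "A < x2" using decu[of x1 c] x1 inv(5) x2_def by simp
    moreover have "x2 \<le> word_map \<beta> u D" using decu[of D x1] x1(3) x2_def
      by (cases "D = x1") auto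
    ultimately have x2: "A < x2" "x2 < c" using uD by auto
    have uu: "interior_orbit \<beta> (u @ u) x1"
      by (rule interior_orbit_append) (use x1 x2 inv in \<open>auto simp: x2_def[symmetric]\<close>)
    show ?thesis
      by (rule interior_orbit_append) (use x c' x1 inv uu in \<open>auto simp: x1_def[symmetric]\<close>)
  qed
  have "renormalizable \<beta> (Suc k) c c'"
    unfolding renormalizable_def phi_pow_Suc_0 phi_pow_Suc_1 u_def[symmetric] v_def[symmetric]
    using inv c' vc' D' int1 int2 by (auto simp: word_map_append D'_def D_def)
  then show ?thesis by blast
qed

text \<open>Each level adds one condition \<open>small\<close>, whose left side tends to 0 as
  \<beta> tends to 1.\<close>

lemma eventually_renormalizable:
  "eventually (\<lambda>\<beta>. \<exists>A c. renormalizable \<beta> k A c) (at_right 1)"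
proof (induction k)
  case 0
  have "eventually (\<lambda>\<beta>::real. \<beta> \<in> {1<..<2}) (at_right 1)"
    by (rule eventually_at_right_real) simp
  then show ?case by eventually_elim (use renormalizable_0 in auto)
next
  case (Suc k)
  let ?f = "\<lambda>\<beta>::real. \<beta> ^ (2 * length ((phi ^^ k) [0])) * (\<beta> ^ length ((phi ^^ k) [1]) - 1)"
  have "(?f \<longlongrightarrow> 1 ^ (2 * length ((phi ^^ k) [0])) * (1 ^ length ((phi ^^ k) [1]) - 1)) (at_right 1)"
    by (intro tendsto_intros)
  then have "eventually (\<lambda>\<beta>. ?f \<beta> < 1) (at_right 1)"
    by (rule order_tendstoD) simp
  moreover have "eventually (\<lambda>\<beta>::real. 1 < \<beta>) (at_right 1)"
    by (simp add: eventually_at_right_less)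
  ultimately show ?case
    using Suc by eventually_elim (use renormalizable_Suc in blast)
qed

section \<open>Expansions of points and the limit of the expansion of 1\<close>

definition expansion :: "real \<Rightarrow> real \<Rightarrow> nat stream" where
  "expansion \<beta> x = smap (\<lambda>y. nat \<lfloor>\<beta> * y\<rfloor>) (siterate (neg_beta \<beta>) x)"

lemma expansion_Stream: "expansion \<beta> x = nat \<lfloor>\<beta> * x\<rfloor> ## expansion \<beta> (neg_beta \<beta> x)"
  unfolding expansion_def by (subst siterate.code) simp

lemma expansion_nth: "expansion \<beta> x !! i = nat \<lfloor>\<beta> * (neg_beta \<beta> ^^ i) x\<rfloor>"
  by (simp add: expansion_def)

lemma neg_beta_eqI:
  assumes "y = real c + 1 - \<beta> * x" "0 < y" "y \<le> 1"
  shows "neg_beta \<beta> x = y" "nat \<lfloor>\<beta> * x\<rfloor> = c"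
proof -
  have "\<lfloor>\<beta> * x\<rfloor> = int c" using assms by (intro floor_unique) auto
  then show "neg_beta \<beta> x = y" "nat \<lfloor>\<beta> * x\<rfloor> = c" using assms(1) by (auto simp: neg_beta_def)
qed

text \<open>A digit is certified by the next value lying in (0, 1), which is known only for
  intermediate values; hence the bound \<open>Suc i < length w\<close>.\<close>

lemma interior_orbit_digits:
  assumes "interior_orbit \<beta> w x" "Suc i < length w"
  shows "(neg_beta \<beta> ^^ i) x = word_map \<beta> (take i w) x"
    "expansion \<beta> x !! i = w ! i" "0 < (neg_beta \<beta> ^^ Suc i) x" "(neg_beta \<beta> ^^ Suc i) x < 1"
proof -
  have *: "neg_beta \<beta> (word_map \<beta> (take j w) x) = word_map \<beta> (take (Suc j) w) x \<and>
      nat \<lfloor>\<beta> * word_map \<beta> (take j w) x\<rfloor> = w ! j" if j: "Suc j < length w" for j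
  proof -
    have "0 < word_map \<beta> (take (Suc j) w) x \<and> word_map \<beta> (take (Suc j) w) x < 1"
      using assms(1) j unfolding interior_orbit_def by blast
    moreover have "word_map \<beta> (take (Suc j) w) x = real (w ! j) + 1 - \<beta> * word_map \<beta> (take j w) x"
      using j by (simp add: take_Suc_conv_app_nth word_map_append)
    ultimately show ?thesis using neg_beta_eqI by (meson less_imp_le)
  qed
  have **: "Suc j < length w \<Longrightarrow> (neg_beta \<beta> ^^ j) x = word_map \<beta> (take j w) x" for j
  proof (induction j)
    case (Suc j)
    then show ?case using *[of j] by simp
  qed simp
  show 1: "(neg_beta \<beta> ^^ i) x = word_map \<beta> (take i w) x" using ** assms(2) by blast
  then show "expansion \<beta> x !! i = w ! i" using * assms(2) by (simp add: expansion_nth)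
  have "(neg_beta \<beta> ^^ Suc i) x = word_map \<beta> (take (Suc i) w) x" using * 1 assms(2) by simp
  then show "0 < (neg_beta \<beta> ^^ Suc i) x" "(neg_beta \<beta> ^^ Suc i) x < 1"
    using assms unfolding interior_orbit_def by auto
qed

text \<open>Besides the digits it is recorded that the orbit of 1 stays below 1; this gives the
  strict inequalities when points are compared with 1.\<close>

theorem eventually_expansion_1:
  "eventually (\<lambda>\<beta>. \<forall>i<N. expansion \<beta> 1 !! i = omega !! i \<and> (neg_beta \<beta> ^^ Suc i) 1 < 1) (at_right 1)"
  using eventually_renormalizable[of "Suc N"]
proof eventually_elim
  case (elim \<beta>)
  let ?w = "(phi ^^ Suc N) [1]"
  have int: "interior_orbit \<beta> ?w 1" using elim unfolding renormalizable_def by auto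
  show ?case
  proof (intro allI impI)
    fix i assume "i < N"
    then have i: "Suc i < length ?w" using length_phi_pow_1[of "Suc N"] by linarith
    then show "expansion \<beta> 1 !! i = omega !! i \<and> (neg_beta \<beta> ^^ Suc i) 1 < 1"
      using interior_orbit_digits[OF int i] omega_nth[of i "Suc N"] by (simp del: funpow.simps)
  qed
qed

section \<open>Itineraries\<close>

text \<open>Inverse of \<open>word_map\<close> for the same word: the start from which the word
  leads to \<open>t\<close>. It is a contraction for nonempty words and \<beta> > 1, which is where
  periodic points come from.\<close>

primrec pull_back :: "real \<Rightarrow> nat list \<Rightarrow> real \<Rightarrow> real" where
  "pull_back \<beta> [] t = t"
| "pull_back \<beta> (c # w) t = (real c + 1 - pull_back \<beta> w t) / \<beta>"

lemma pull_back_diff: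
  "pull_back \<beta> w s - pull_back \<beta> w t = (- 1 / \<beta>) ^ length w * (s - t)"
proof (induction w)
  case (Cons c w)
  have "pull_back \<beta> (c # w) s - pull_back \<beta> (c # w) t = (- 1 / \<beta>) * (pull_back \<beta> w s - pull_back \<beta> w t)"
    by (simp add: diff_divide_distrib)
  then show ?case unfolding Cons.IH by (simp add: mult.assoc)
qed simp

lemma pull_back_fixpoint:
  assumes "1 < \<beta>" "w \<noteq> []"
  shows "\<exists>t. pull_back \<beta> w t = t"
proof -
  define e where "e = (- 1 / \<beta>) ^ length w"
  have "\<bar>e\<bar> = (1 / \<beta>) ^ length w" using assms(1) by (simp add: e_def power_abs)
  also have "\<dots> < 1" using assms by (intro power_less_one_iff[THEN iffD2]) auto
  finally have e: "e < 1" by simp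
  \<comment> \<open>The map is affine with slope \<open>e\<close>, so its fixed point is its value
    at 0 divided by 1 - e.\<close>
  let ?t = "pull_back \<beta> w 0 / (1 - e)"
  have "pull_back \<beta> w ?t = pull_back \<beta> w 0 + e * ?t"
    using pull_back_diff[of \<beta> w ?t 0] by (simp add: e_def)
  also have "\<dots> = ?t" using e by (simp add: field_simps)
  finally show ?thesis by blast
qed

text \<open>A finite orbit with ranks \<rho> and digits \<zeta>, whose last position
  \<open>N\<close> has no digit and borrows the itinerary of \<open>ref\<close>. By
  \<open>adjacent\<close>, no other rank lies between those of \<open>ref\<close> and
  \<open>N\<close>. The abstraction serves \<open>z\<close>, \<open>z_alt\<close> and the orbit
  prolonged by one position alike.\<close>

locale itinerary =
  fixes N :: nat and \<rho> \<zeta> :: "nat \<Rightarrow> nat" and ref :: nat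
  assumes inj: "inj_on \<rho> {1..N}"
    and ref: "1 \<le> ref" "ref < N"
    and digit_mono: "\<lbrakk>1 \<le> i; i < N; 1 \<le> j; j < N; \<rho> i < \<rho> j\<rbrakk> \<Longrightarrow> \<zeta> i \<le> \<zeta> j"
    and digit_flip: "\<lbrakk>1 \<le> i; i < N; 1 \<le> j; j < N; \<rho> i < \<rho> j; \<zeta> i = \<zeta> j\<rbrakk> \<Longrightarrow> \<rho> (Suc j) < \<rho> (Suc i)"
    and adjacent: "\<lbrakk>1 \<le> i; i < N; i \<noteq> ref\<rbrakk> \<Longrightarrow> \<rho> i < \<rho> ref \<longleftrightarrow> \<rho> i < \<rho> N"
begin

definition itin :: "nat \<Rightarrow> nat stream" where
  "itin j = map \<zeta> [j..<N] @- cycle (map \<zeta> [ref..<N])"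

lemma itin_N: "itin N = itin ref"
  using cycle_decomp[of "map \<zeta> [ref..<N]"] ref by (simp add: itin_def)

lemma itin_Stream: "j < N \<Longrightarrow> itin j = \<zeta> j ## itin (Suc j)"
  by (simp add: itin_def upt_conv_Cons)

text \<open>Successor after identifying \<open>N\<close> with \<open>ref\<close>. It never leaves
  the positions below \<open>N\<close>, so it can be followed forever.\<close>

definition nxt :: "nat \<Rightarrow> nat" where
  "nxt j = (if Suc j = N then ref else Suc j)"

lemma nxt: "j < N \<Longrightarrow> 1 \<le> nxt j" "j < N \<Longrightarrow> nxt j < N" "j < N \<Longrightarrow> itin j = \<zeta> j ## itin (nxt j)"
  using ref itin_N itin_Stream by (auto simp: nxt_def)

text \<open>By adjacency, replacing \<open>N\<close> by \<open>ref\<close> destroys strictness only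
  for the pair formed by these two and never reverses an inequality.\<close>

lemma rank_less_imp_le:
  assumes "i \<in> {1..N}" "j \<in> {1..N}" "\<rho> i < \<rho> j"
  shows "\<rho> (if i = N then ref else i) \<le> \<rho> (if j = N then ref else j)"
proof -
  have ne: "\<rho> a \<noteq> \<rho> b" if "a \<in> {1..N}" "b \<in> {1..N}" "a \<noteq> b" for a b
    using inj that unfolding inj_on_def by blast
  consider "i = N" "j \<noteq> N" | "i \<noteq> N" "j = N" | "i \<noteq> N" "j \<noteq> N" using assms by blast
  then show ?thesis
  proof cases
    case 1
    then show ?thesis using adjacent[of j] assms ne[of j ref] ref by (cases "j = ref") auto
  next
    case 2
    then show ?thesis using adjacent[of i] assms ref by (cases "i = ref") auto
  qed (use assms in auto)
qed

lemma rank_nxt: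
  assumes "1 \<le> i" "i < N" "1 \<le> j" "j < N" "\<rho> i < \<rho> j" "\<zeta> i = \<zeta> j"
  shows "\<rho> (nxt j) \<le> \<rho> (nxt i)"
  unfolding nxt_def by (rule rank_less_imp_le[OF _ _ digit_flip[OF assms]]) (use assms(2,4) in auto)

text \<open>The claim concerns a single index k after agreement on k letters, so that induction on k
  applies. Each step exchanges i and j, in accordance with the alternation of the order.\<close>

lemma itin_mono_aux:
  assumes "1 \<le> i" "i < N" "1 \<le> j" "j < N" "\<rho> i \<le> \<rho> j" "\<forall>x<k. itin j !! x = itin i !! x"
  shows "\<not> (if even k then itin j !! k < itin i !! k else itin i !! k < itin j !! k)"
  using assms
proof (induction k arbitrary: i j)
  case 0
  have "i = j" if "\<rho> i = \<rho> j"
    by (rule inj_onD[OF inj that]) (use 0 in auto)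
  then have "\<zeta> i \<le> \<zeta> j" using digit_mono[of i j] 0 by (cases "\<rho> i = \<rho> j") auto
  then show ?case using nxt(3)[OF 0(2)] nxt(3)[OF 0(4)] by simp
next
  case (Suc k)
  note ii = nxt[OF Suc.prems(2)] and jj = nxt[OF Suc.prems(4)]
  show ?case
  proof (cases "i = j")
    case False
    have "i = j" if "\<rho> i = \<rho> j"
      by (rule inj_onD[OF inj that]) (use Suc.prems in auto)
    then have less: "\<rho> i < \<rho> j" using Suc.prems(5) False by linarith
    have "itin j !! 0 = itin i !! 0" using Suc.prems(6) by blast
    then have dig: "\<zeta> i = \<zeta> j" unfolding ii(3) jj(3) by simp
    have "itin (nxt i) !! x = itin (nxt j) !! x" if "x < k" for x
    proof -
      have "itin j !! Suc x = itin i !! Suc x" using Suc.prems(6) that by blast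
      then show ?thesis unfolding ii(3) jj(3) by simp
    qed
    then have "\<not> (if even k then itin (nxt i) !! k < itin (nxt j) !! k else itin (nxt j) !! k < itin (nxt i) !! k)"
      using Suc.IH[OF jj(1,2) ii(1,2)] rank_nxt[OF Suc.prems(1-4) less dig] by blast
    then show ?thesis unfolding ii(3) jj(3) by (auto split: if_splits)
  qed simp
qed

lemma itin_mono:
  assumes "i \<in> {1..N}" "j \<in> {1..N}" "\<rho> i \<le> \<rho> j"
  shows "\<not> altlex (itin j) (itin i)"
proof (cases "i = j")
  case False
  then have less: "\<rho> i < \<rho> j" using assms inj by (metis inj_on_eq_iff le_neq_implies_less)
  let ?h = "\<lambda>i. if i = N then ref else i"
  have h: "1 \<le> ?h k" "?h k < N" "itin (?h k) = itin k" if "k \<in> {1..N}" for k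
    using that ref itin_N by auto
  have "\<not> altlex (itin (?h j)) (itin (?h i))"
    using itin_mono_aux[OF h(1,2)[OF assms(1)] h(1,2)[OF assms(2)] rank_less_imp_le[OF assms(1,2) less]]
    unfolding altlex_def by blast
  then show ?thesis using h(3)[OF assms(1)] h(3)[OF assms(2)] by simp
qed (simp add: altlex_irrefl)

lemma itin_range: "j \<in> {1..N} \<Longrightarrow> \<exists>i\<in>{1..<N}. itin j = itin i"
  using itin_N ref by (cases "j = N") force+

text \<open>That shifts are again itineraries of positions yields both the finiteness of the set of
  shifts and shift-maximality at the position of largest rank.\<close>

lemma sdrop_itin:
  assumes "j \<in> {1..N}"
  shows "sdrop i (itin j) \<in> itin ` {1..<N}"
proof (induction i)
  case 0
  then show ?case using itin_range[OF assms] by auto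
next
  case (Suc i)
  then obtain k where k: "k \<in> {1..<N}" "sdrop i (itin j) = itin k" by blast
  have "sdrop (Suc i) (itin j) = stl (itin k)" using k(2) by (metis sdrop_stl sdrop.simps(2))
  also have "\<dots> = itin (nxt k)" using nxt(3)[of k] k(1) by simp
  finally show ?case using nxt(1,2)[of k] k(1) by auto
qed

lemma itin_shift_maximal:
  assumes "m \<in> {1..N}" "\<And>j. j \<in> {1..N} \<Longrightarrow> \<rho> j \<le> \<rho> m"
  shows "\<not> altlex (itin m) (sdrop i (itin m))"
proof -
  obtain j where "j \<in> {1..<N}" "sdrop i (itin m) = itin j" using sdrop_itin[OF assms(1)] by blast
  then show ?thesis using itin_mono[of j m] assms by auto
qed

lemma finite_shifts_itin: "m \<in> {1..N} \<Longrightarrow> finite (range (\<lambda>i. sdrop i (itin m)))"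
  by (rule finite_subset[of _ "itin ` {1..<N}"]) (use sdrop_itin in auto)

lemma sset_itin: "sset (itin j) \<subseteq> \<zeta> ` {j..<N} \<union> \<zeta> ` {ref..<N}"
  using sset_cycle_subset[of "map \<zeta> [ref..<N]"] ref by (auto simp: itin_def)

text \<open>This runs along true positions instead of \<open>nxt\<close>, so ranks stay strictly
  comparable up to \<open>N\<close> itself.\<close>

lemma tie_flip:
  assumes "1 \<le> i" "1 \<le> j" "itin i = itin j" "\<rho> i < \<rho> j" "i + t \<le> N" "j + t \<le> N"
  shows "itin (i + t) = itin (j + t) \<and>
    (if even t then \<rho> (i + t) < \<rho> (j + t) else \<rho> (j + t) < \<rho> (i + t))"
  using assms(5,6)
proof (induction t)
  case 0
  then show ?case using assms by simp
next
  case (Suc t)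
  then have IH: "itin (i + t) = itin (j + t)"
    "if even t then \<rho> (i + t) < \<rho> (j + t) else \<rho> (j + t) < \<rho> (i + t)" by auto
  have bd: "1 \<le> i + t" "i + t < N" "1 \<le> j + t" "j + t < N" using Suc.prems assms by auto
  have "\<zeta> (i + t) ## itin (Suc (i + t)) = \<zeta> (j + t) ## itin (Suc (j + t))"
    using IH(1) itin_Stream bd by metis
  then have eq: "\<zeta> (i + t) = \<zeta> (j + t)" "itin (Suc (i + t)) = itin (Suc (j + t))" by auto
  show ?case using digit_flip[OF bd(1-4)] digit_flip[OF bd(3,4,1,2)] eq IH(2)
    by (auto split: if_splits)
qed

section \<open>Points with prescribed itineraries\<close>

definition point :: "real \<Rightarrow> real \<Rightarrow> nat \<Rightarrow> real" where
  "point \<beta> t j = pull_back \<beta> (map \<zeta> [j..<N]) t"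

lemma point_N: "point \<beta> t N = t"
  by (simp add: point_def)

lemma point_Suc: "j < N \<Longrightarrow> point \<beta> t j = (real (\<zeta> j) + 1 - point \<beta> t (Suc j)) / \<beta>"
  by (simp add: point_def upt_conv_Cons)

lemma point_perturb: "point \<beta> (t + d) j = point \<beta> t j + (- 1 / \<beta>) ^ (N - j) * d"
  using pull_back_diff[of \<beta> "map \<zeta> [j..<N]" "t + d" t] by (simp add: point_def)

lemma exists_periodic_point: "1 < \<beta> \<Longrightarrow> \<exists>t. point \<beta> t ref = t"
  unfolding point_def by (rule pull_back_fixpoint) (use ref in auto)

lemma point_nxt:
  assumes "point \<beta> t ref = t" "j < N"
  shows "point \<beta> t j = (real (\<zeta> j) + 1 - point \<beta> t (nxt j)) / \<beta>"
  using point_Suc[OF assms(2), of \<beta> t] assms(1) point_N[of \<beta> t] by (auto simp: nxt_def)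

text \<open>The points are not yet known to lie in (0, 1); \<open>M\<close> is just an upper bound
  for them. As digits are nonnegative, it implies the lower bound -(M - 1) / \<beta>. So the error
  at the first differing letter is governed by M - 1, and the preceding common letters only shrink
  it. Both directions are proved together because each step reverses differences.\<close>

lemma point_upper_aux:
  assumes "1 < \<beta>" "point \<beta> t ref = t" "1 \<le> M" "\<And>j. j \<in> {1..N} \<Longrightarrow> point \<beta> t j \<le> M"
    and "1 \<le> j" "j < N" "0 < e" "e \<le> 1" "\<forall>x<k. itin j !! x = expansion \<beta> e !! x"
    "(neg_beta \<beta> ^^ Suc k) e < 1"
  shows "(if even k then itin j !! k < expansion \<beta> e !! k else expansion \<beta> e !! k < itin j !! k)
      \<Longrightarrow> point \<beta> t j - e < (M - 1) / \<beta>"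
    and "(if even k then expansion \<beta> e !! k < itin j !! k else itin j !! k < expansion \<beta> e !! k)
      \<Longrightarrow> - (M - 1) / \<beta> < point \<beta> t j - e"
proof -
  have M: "(M - 1) / \<beta> \<le> M - 1" using assms(1,3) mult_left_mono[of 1 \<beta> "M - 1"] by (simp add: divide_le_eq)
  have *: "((if even k then itin j !! k < expansion \<beta> e !! k else expansion \<beta> e !! k < itin j !! k)
      \<longrightarrow> point \<beta> t j - e < (M - 1) / \<beta>) \<and>
    ((if even k then expansion \<beta> e !! k < itin j !! k else itin j !! k < expansion \<beta> e !! k)
      \<longrightarrow> - (M - 1) / \<beta> < point \<beta> t j - e)"
    using assms(5-10)
  proof (induction k arbitrary: j e)
    case (0 j e)
    have jN: "j < N" using 0 by simp
    note nx = nxt[OF jN]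
    define d where "d = nat \<lfloor>\<beta> * e\<rfloor>"
    have d: "\<beta> * e = real d + 1 - neg_beta \<beta> e"
      using 0 assms(1) by (simp add: d_def neg_beta_def)
    have Te: "0 < neg_beta \<beta> e" "neg_beta \<beta> e < 1" using neg_beta_in[of \<beta> e] 0 by auto
    have pj: "\<beta> * point \<beta> t j = real (\<zeta> j) + 1 - point \<beta> t (nxt j)"
      using point_nxt[OF assms(2) jN] assms(1) by simp
    have diff: "\<beta> * (point \<beta> t j - e) = real (\<zeta> j) - real d - point \<beta> t (nxt j) + neg_beta \<beta> e"
      using d pj by (simp add: right_diff_distrib)
    have up: "point \<beta> t (nxt j) \<le> M" using assms(4)[of "nxt j"] nx by simp
    have "\<beta> * point \<beta> t (nxt j) = real (\<zeta> (nxt j)) + 1 - point \<beta> t (nxt (nxt j))"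
      using point_nxt[OF assms(2) nx(2)] assms(1) by simp
    moreover have "point \<beta> t (nxt (nxt j)) \<le> M" using assms(4)[of "nxt (nxt j)"] nxt[OF nx(2)] by simp
    ultimately have "1 - M \<le> \<beta> * point \<beta> t (nxt j)" by linarith
    then have "- point \<beta> t (nxt j) \<le> (M - 1) / \<beta>" using assms(1) by (simp add: field_simps)
    then have lo: "- point \<beta> t (nxt j) \<le> M - 1" using M by linarith
    have heads: "itin j !! 0 = \<zeta> j" "expansion \<beta> e !! 0 = d"
      using expansion_nth[of \<beta> e 0] unfolding nx(3) by (simp_all add: d_def)
    have 1: "point \<beta> t j - e < (M - 1) / \<beta>" if "\<zeta> j < d"
    proof -
      have "real (\<zeta> j) + 1 \<le> real d" using that by simp
      then have "\<beta> * (point \<beta> t j - e) < M - 1" using diff lo Te by linarith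
      then show ?thesis using assms(1) by (simp add: less_divide_eq mult.commute)
    qed
    have 2: "- (M - 1) / \<beta> < point \<beta> t j - e" if "d < \<zeta> j"
    proof -
      have "real d + 1 \<le> real (\<zeta> j)" using that by simp
      then have "- (M - 1) < \<beta> * (point \<beta> t j - e)" using diff up Te by linarith
      then show ?thesis using assms(1) by (simp add: divide_less_eq mult.commute)
    qed
    show ?case unfolding heads using 1 2 by simp
  next
    case (Suc k j e)
    have jN: "j < N" using Suc.prems by simp
    note nx = nxt[OF jN]
    define d where "d = nat \<lfloor>\<beta> * e\<rfloor>"
    have d: "\<beta> * e = real d + 1 - neg_beta \<beta> e"
      using Suc.prems assms(1) by (simp add: d_def neg_beta_def)
    have ex: "expansion \<beta> e = d ## expansion \<beta> (neg_beta \<beta> e)"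
      unfolding d_def by (rule expansion_Stream)
    have agree0: "itin j !! 0 = expansion \<beta> e !! 0" using Suc.prems(5) by blast
    then have zd: "\<zeta> j = d" unfolding nx(3) ex by simp
    have agree: "\<forall>x<k. itin (nxt j) !! x = expansion \<beta> (neg_beta \<beta> e) !! x"
    proof (intro allI impI)
      fix x assume "x < k"
      then have "itin j !! Suc x = expansion \<beta> e !! Suc x" using Suc.prems(5) by blast
      then show "itin (nxt j) !! x = expansion \<beta> (neg_beta \<beta> e) !! x" unfolding nx(3) ex by simp
    qed
    have pj: "\<beta> * point \<beta> t j = real (\<zeta> j) + 1 - point \<beta> t (nxt j)"
      using point_nxt[OF assms(2) jN] assms(1) by simp
    have diff: "point \<beta> t j - e = - (point \<beta> t (nxt j) - neg_beta \<beta> e) / \<beta>"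
      using d pj zd assms(1) by (simp add: field_simps)
    have T: "0 < neg_beta \<beta> e" "neg_beta \<beta> e \<le> 1" using neg_beta_in[of \<beta> e] by auto
    have "(neg_beta \<beta> ^^ Suc k) (neg_beta \<beta> e) < 1"
      using Suc.prems(6) by (simp add: funpow_swap1)
    note IH = Suc.IH[OF nx(1,2) T agree this]
    have tr1: "- y / \<beta> < (M - 1) / \<beta>" if "- (M - 1) / \<beta> < y" for y
    proof -
      have "- (M - 1) / \<beta> = - ((M - 1) / \<beta>)" by (rule minus_divide_left[symmetric])
      then have "- y < M - 1" using that M by linarith
      then show ?thesis using assms(1) by (intro divide_strict_right_mono) auto
    qed
    have tr2: "- (M - 1) / \<beta> < - y / \<beta>" if "y < (M - 1) / \<beta>" for y
    proof -
      have "- (M - 1) < - y" using that M by simp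
      then show ?thesis using assms(1) by (intro divide_strict_right_mono) auto
    qed
    have nths: "itin j !! Suc k = itin (nxt j) !! k" "expansion \<beta> e !! Suc k = expansion \<beta> (neg_beta \<beta> e) !! k"
      using arg_cong[OF nx(3), of "\<lambda>s. s !! Suc k"] unfolding ex by simp_all
    define y where "y = point \<beta> t (nxt j) - neg_beta \<beta> e"
    show ?case unfolding nths diff y_def[symmetric]
      using IH[folded y_def] tr1[of y] tr2[of y] by (cases "even k") auto
  qed
  show "(if even k then itin j !! k < expansion \<beta> e !! k else expansion \<beta> e !! k < itin j !! k)
      \<Longrightarrow> point \<beta> t j - e < (M - 1) / \<beta>"
    and "(if even k then expansion \<beta> e !! k < itin j !! k else itin j !! k < expansion \<beta> e !! k)
      \<Longrightarrow> - (M - 1) / \<beta> < point \<beta> t j - e"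
    using * by auto
qed

lemma point_in_unit_interval:
  assumes "1 < \<beta>" "point \<beta> t ref = t"
    and less: "\<And>j. 1 \<le> j \<Longrightarrow> j < N \<Longrightarrow> \<exists>k. (\<forall>x<k. itin j !! x = expansion \<beta> 1 !! x) \<and>
      (if even k then itin j !! k < expansion \<beta> 1 !! k else expansion \<beta> 1 !! k < itin j !! k) \<and>
      (neg_beta \<beta> ^^ Suc k) 1 < 1"
    and "j \<in> {1..N}"
  shows "0 < point \<beta> t j \<and> point \<beta> t j < 1"
proof -
  define M where "M = Max (point \<beta> t ` {1..N})"
  have fin: "finite (point \<beta> t ` {1..N})" "point \<beta> t ` {1..N} \<noteq> {}" using ref by auto
  have le: "point \<beta> t j \<le> M" if "j \<in> {1..N}" for j using that fin by (simp add: M_def)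
  have M: "M < 1"
  proof (rule ccontr)
    assume "\<not> M < 1"
    then have M1: "1 \<le> M" by simp
    obtain j where "j \<in> {1..N}" "point \<beta> t j = M" using Max_in[OF fin] M_def by auto
    then obtain j where j: "1 \<le> j" "j < N" "point \<beta> t j = M"
      using assms(2) point_N[of \<beta> t] ref by (cases "j = N") auto
    obtain k where k: "\<forall>x<k. itin j !! x = expansion \<beta> 1 !! x"
      "if even k then itin j !! k < expansion \<beta> 1 !! k else expansion \<beta> 1 !! k < itin j !! k"
      "(neg_beta \<beta> ^^ Suc k) 1 < 1" using less[OF j(1,2)] by blast
    \<comment> \<open>Comparison with e = 1 at a position where the maximum is attained; it is
      incompatible with 1 <= M.\<close>
    have "M - 1 < (M - 1) / \<beta>"
      using point_upper_aux(1)[OF assms(1,2) M1 le j(1,2) _ _ k(1,3,2)] j(3) by simp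
    then have "(M - 1) * \<beta> < (M - 1) * 1" using assms(1) by (simp add: less_divide_eq)
    moreover have "(M - 1) * 1 \<le> (M - 1) * \<beta>" using M1 assms(1) by (intro mult_left_mono) auto
    ultimately show False by simp
  qed
  have pos: "0 < point \<beta> t j" if "j < N" "1 \<le> j" for j
  proof -
    have "point \<beta> t (nxt j) \<le> M" using le[of "nxt j"] nxt[OF that(1)] by simp
    then show ?thesis using point_nxt[OF assms(2) that(1)] M assms(1) by simp
  qed
  show ?thesis
    using le[OF assms(4)] M pos[of j] pos[of ref] assms(2,4) point_N[of \<beta> t] ref by (cases "j = N") auto
qed

lemma point_strict_mono:
  assumes "1 < \<beta>" "point \<beta> t ref = t" "\<And>j. j \<in> {1..N} \<Longrightarrow> 0 < point \<beta> t j \<and> point \<beta> t j < 1"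
    and "i \<in> {1..N}" "j \<in> {1..N}" "altlex (itin i) (itin j)"
  shows "point \<beta> t i < point \<beta> t j"
proof -
  have *: "point \<beta> t i < point \<beta> t j"
    if "1 \<le> i" "i < N" "1 \<le> j" "j < N" "\<forall>x<k. itin i !! x = itin j !! x"
      "if even k then itin i !! k < itin j !! k else itin j !! k < itin i !! k" for i j k
    using that
  proof (induction k arbitrary: i j)
    case (0 i j)
    note ni = nxt[OF 0(2)] and nj = nxt[OF 0(4)]
    have "itin i !! 0 < itin j !! 0" using 0(6) by simp
    then have "\<zeta> i < \<zeta> j" unfolding ni(3) nj(3) by simp
    then have "real (\<zeta> i) + 1 \<le> real (\<zeta> j)" by simp
    then have "real (\<zeta> i) + 1 - point \<beta> t (nxt i) < real (\<zeta> j) + 1 - point \<beta> t (nxt j)"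
      using assms(3)[of "nxt i"] assms(3)[of "nxt j"] ni nj by simp
    then show ?case using point_nxt[OF assms(2) 0(2)] point_nxt[OF assms(2) 0(4)] assms(1)
      by (simp add: divide_strict_right_mono)
  next
    case (Suc k i j)
    note ni = nxt[OF Suc.prems(2)] and nj = nxt[OF Suc.prems(4)]
    have "itin i !! 0 = itin j !! 0" using Suc.prems(5) by blast
    then have dig: "\<zeta> i = \<zeta> j" unfolding ni(3) nj(3) by simp
    have agree: "\<forall>x<k. itin (nxt j) !! x = itin (nxt i) !! x"
    proof (intro allI impI)
      fix x assume "x < k"
      then have "itin i !! Suc x = itin j !! Suc x" using Suc.prems(5) by blast
      then show "itin (nxt j) !! x = itin (nxt i) !! x" unfolding ni(3) nj(3) by simp
    qed
    have nths: "itin i !! Suc k = itin (nxt i) !! k" "itin j !! Suc k = itin (nxt j) !! k"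
      using arg_cong[OF ni(3), of "\<lambda>s. s !! Suc k"] arg_cong[OF nj(3), of "\<lambda>s. s !! Suc k"]
      by simp_all
    have "point \<beta> t (nxt j) < point \<beta> t (nxt i)"
      by (rule Suc.IH[OF nj(1,2) ni(1,2) agree]) (use Suc.prems(6) nths in \<open>auto split: if_splits\<close>)
    then show ?case
      using point_nxt[OF assms(2) Suc.prems(2)] point_nxt[OF assms(2) Suc.prems(4)] dig assms(1)
      by (simp add: divide_strict_right_mono)
  qed
  let ?h = "\<lambda>i. if i = N then ref else i"
  have h: "1 \<le> ?h k" "?h k < N" "itin (?h k) = itin k" "point \<beta> t (?h k) = point \<beta> t k"
    if "k \<in> {1..N}" for k
    using that ref itin_N point_N[of \<beta> t] assms(2) by auto
  show ?thesis
    using *[OF h(1,2)[OF assms(4)] h(1,2)[OF assms(5)]] assms(6)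
    unfolding altlex_def h(3)[OF assms(4)] h(3)[OF assms(5)] h(4)[OF assms(4)] h(4)[OF assms(5)] by blast
qed

end

section \<open>Resolving ties by moving the last point\<close>

context itinerary
begin

text \<open>Tied positions share a point, so the displacements caused by moving the last point
  decide their order. Follow both until the later one reaches \<open>N\<close>. The earlier one is
  then at a position tied with \<open>ref\<close>, whose side is fixed by \<open>tie\<close>, and
  the parity of the number of steps gives the sign of the displacement of the later one, which is
  the larger in absolute value.\<close>

lemma tie_order:
  assumes "1 < \<beta>"
    and tie: "\<And>i. 1 \<le> i \<Longrightarrow> i < N \<Longrightarrow> itin i = itin ref \<Longrightarrow> \<rho> i < \<rho> N \<longleftrightarrow> \<rho> ref < \<rho> N"
    and "i \<in> {1..N}" "j \<in> {1..N}" "itin i = itin j" "\<rho> i < \<rho> j"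
  defines "\<sigma> \<equiv> if \<rho> ref < \<rho> N then 1 else - 1 :: real"
  shows "\<sigma> * (- 1 / \<beta>) ^ (N - i) < \<sigma> * (- 1 / \<beta>) ^ (N - j)"
proof -
  define e where "e = - 1 / \<beta>"
  have e: "e < 0" "\<bar>e\<bar> < 1" using assms(1) by (auto simp: e_def)
  have pow: "e ^ f < 1" if "0 < f" for f
  proof -
    have "\<bar>e\<bar> ^ f < 1" using e that by (intro power_less_one_iff[THEN iffD2]) auto
    then show ?thesis by (simp flip: power_abs)
  qed
  have "i \<noteq> j" using assms(6) by auto
  then consider "i < j" | "j < i" by linarith
  then have "\<sigma> * e ^ (N - i) < \<sigma> * e ^ (N - j)"
  proof cases
    case 1
    define t f where "t = N - j" and "f = j - i"
    have tf: "N - i = t + f" "0 < f" "j + t = N" "i + t < N" "1 \<le> i + t" using 1 assms(3,4)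
      by (auto simp: t_def f_def)
    have *: "itin (i + t) = itin N \<and> (if even t then \<rho> (i + t) < \<rho> N else \<rho> N < \<rho> (i + t))"
      using tie_flip[of i j t, unfolded tf(3)] assms(3-6) tf(4) by auto
    then have "\<rho> (i + t) < \<rho> N \<longleftrightarrow> \<rho> ref < \<rho> N" using tie[of "i + t"] tf itin_N by simp
    then have "even t \<longleftrightarrow> \<rho> ref < \<rho> N" using * by (auto split: if_splits)
    then have "0 < \<sigma> * e ^ t" using e
      by (cases "even t") (auto simp: \<sigma>_def zero_less_power_eq mult_neg_neg power_less_zero_eq)
    then have "\<sigma> * e ^ t * e ^ f < \<sigma> * e ^ t * 1" using pow[OF tf(2)] by (intro mult_strict_left_mono)
    then show ?thesis unfolding tf(1) t_def[symmetric] by (simp add: power_add mult.assoc)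
  next
    case 2
    define t f where "t = N - i" and "f = i - j"
    have tf: "N - j = t + f" "0 < f" "i + t = N" "j + t < N" "1 \<le> j + t" using 2 assms(3,4)
      by (auto simp: t_def f_def)
    have *: "itin (j + t) = itin N \<and> (if even t then \<rho> N < \<rho> (j + t) else \<rho> (j + t) < \<rho> N)"
      using tie_flip[of i j t, unfolded tf(3)] assms(3-6) tf(4) by auto
    then have "\<rho> (j + t) < \<rho> N \<longleftrightarrow> \<rho> ref < \<rho> N" using tie[of "j + t"] tf itin_N by simp
    then have "odd t \<longleftrightarrow> \<rho> ref < \<rho> N" using * by (auto split: if_splits)
    then have "\<sigma> * e ^ t < 0" using e
      by (cases "even t") (auto simp: \<sigma>_def zero_less_power_eq power_less_zero_eq)
    then have "\<sigma> * e ^ t * 1 < \<sigma> * e ^ t * e ^ f" using pow[OF tf(2)] by (intro mult_strict_left_mono_neg)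
    then show ?thesis unfolding tf(1) t_def[symmetric] by (simp add: power_add mult.assoc)
  qed
  then show ?thesis by (simp add: e_def)
qed

text \<open>Equal heads cancel and successors of tied positions are tied, so the largest distance
  within tied pairs is at most itself divided by \<beta>.\<close>

lemma point_cong:
  assumes "1 < \<beta>" "point \<beta> t ref = t" "i \<in> {1..N}" "j \<in> {1..N}" "itin i = itin j"
  shows "point \<beta> t i = point \<beta> t j"
proof -
  define S where "S = {(i, j). i \<in> {1..<N} \<and> j \<in> {1..<N} \<and> itin i = itin j}"
  define f where "f = (\<lambda>(i, j). \<bar>point \<beta> t i - point \<beta> t j\<bar>)"
  have "finite S" by (rule finite_subset[of _ "{1..<N} \<times> {1..<N}"]) (auto simp: S_def)
  moreover have "(ref, ref) \<in> S" using ref by (simp add: S_def)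
  ultimately have fin: "finite (f ` S)" "f ` S \<noteq> {}" by auto
  define M where "M = Max (f ` S)"
  have le: "f p \<le> M" if "p \<in> S" for p using fin that by (simp add: M_def)
  have "M \<in> f ` S" using Max_in[OF fin] by (simp add: M_def)
  then obtain a b where ab: "(a, b) \<in> S" "f (a, b) = M" by auto
  then have na: "1 \<le> a" "a < N" and nb: "1 \<le> b" "b < N" by (auto simp: S_def)
  note an = nxt[OF na(2)] and bn = nxt[OF nb(2)]
  have "\<zeta> a ## itin (nxt a) = \<zeta> b ## itin (nxt b)" using ab(1) an(3) bn(3) by (simp add: S_def)
  then have dig: "\<zeta> a = \<zeta> b" "(nxt a, nxt b) \<in> S" using an bn by (auto simp: S_def)
  have "f (a, b) = f (nxt a, nxt b) / \<beta>"
    unfolding f_def prod.case point_nxt[OF assms(2) na(2)] point_nxt[OF assms(2) nb(2)]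
    using assms(1) dig(1) by (simp add: diff_divide_distrib[symmetric] abs_minus_commute)
  also have "\<dots> \<le> M / \<beta>" using le[OF dig(2)] assms(1) by (simp add: divide_right_mono)
  finally have "M * \<beta> \<le> M * 1" using ab(2) assms(1) by (simp add: le_divide_eq)
  moreover have "M * 1 < M * \<beta>" if "0 < M" using that assms(1) by (intro mult_strict_left_mono)
  ultimately have "M \<le> 0" by (meson not_less)
  have *: "point \<beta> t i = point \<beta> t j" if "(i, j) \<in> S" for i j
    using le[OF that] \<open>M \<le> 0\<close> by (simp add: f_def)
  let ?h = "\<lambda>i. if i = N then ref else i"
  have h: "?h k \<in> {1..<N}" "itin (?h k) = itin k" "point \<beta> t (?h k) = point \<beta> t k"
    if "k \<in> {1..N}" for k
    using that ref itin_N point_N[of \<beta> t] assms(2) by auto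
  have "(?h i, ?h j) \<in> S"
    unfolding S_def using h(1,2)[OF assms(3)] h(1,2)[OF assms(4)] assms(5) by simp
  then show ?thesis using *[of "?h i" "?h j"] h(3)[OF assms(3)] h(3)[OF assms(4)] by simp
qed

lemma realize_order:
  assumes "1 < \<beta>"
    and less: "\<And>j. 1 \<le> j \<Longrightarrow> j < N \<Longrightarrow> \<exists>k. (\<forall>x<k. itin j !! x = expansion \<beta> 1 !! x) \<and>
      (if even k then itin j !! k < expansion \<beta> 1 !! k else expansion \<beta> 1 !! k < itin j !! k) \<and>
      (neg_beta \<beta> ^^ Suc k) 1 < 1"
    and tie: "\<And>i. 1 \<le> i \<Longrightarrow> i < N \<Longrightarrow> itin i = itin ref \<Longrightarrow> \<rho> i < \<rho> N \<longleftrightarrow> \<rho> ref < \<rho> N"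
  shows "\<exists>x\<in>{0<..1}. \<forall>i\<in>{1..N}. \<forall>j\<in>{1..N}. \<rho> i < \<rho> j \<longrightarrow>
    (neg_beta \<beta> ^^ (i - 1)) x < (neg_beta \<beta> ^^ (j - 1)) x"
proof -
  obtain t where t: "point \<beta> t ref = t" using exists_periodic_point[OF assms(1)] by blast
  \<comment> \<open>The points of \<open>N\<close> and \<open>ref\<close> coincide at first;
    \<sigma> is the direction in which the ranks require the point of \<open>N\<close> to
    move.\<close>
  define \<sigma> where "\<sigma> = (if \<rho> ref < \<rho> N then 1 else - 1 :: real)"
  define y where "y = (\<lambda>\<eta> j. point \<beta> (t + \<sigma> * \<eta>) j)"
  have y: "y \<eta> j = point \<beta> t j + (\<sigma> * (- 1 / \<beta>) ^ (N - j)) * \<eta>" for \<eta> j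
    by (simp add: y_def point_perturb mult_ac)
  have unit: "0 < point \<beta> t j \<and> point \<beta> t j < 1" if "j \<in> {1..N}" for j
    using point_in_unit_interval[OF assms(1) t less that] .
  have lim: "((\<lambda>\<eta>. y \<eta> j) \<longlongrightarrow> point \<beta> t j) (at_right 0)" for j
  proof -
    have "((\<lambda>\<eta>. point \<beta> t j + (\<sigma> * (- 1 / \<beta>) ^ (N - j)) * \<eta>) \<longlongrightarrow>
        point \<beta> t j + (\<sigma> * (- 1 / \<beta>) ^ (N - j)) * 0) (at_right 0)"
      by (intro tendsto_intros)
    then show ?thesis by (simp add: y)
  qed
  have "eventually (\<lambda>\<eta>. \<forall>j\<in>{1..N}. 0 < y \<eta> j \<and> y \<eta> j < 1) (at_right 0)"
    using unit by (intro eventually_ball_finite ballI eventually_conj order_tendstoD[OF lim]) auto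
  moreover have "eventually (\<lambda>\<eta>. \<forall>i\<in>{1..N}. \<forall>j\<in>{1..N}. \<rho> i < \<rho> j \<longrightarrow> y \<eta> i < y \<eta> j) (at_right 0)"
  proof (intro eventually_ball_finite ballI)
    fix i j assume ij: "i \<in> {1..N}" "j \<in> {1..N}"
    show "eventually (\<lambda>\<eta>. \<rho> i < \<rho> j \<longrightarrow> y \<eta> i < y \<eta> j) (at_right 0)"
    proof (cases "\<rho> i < \<rho> j")
      case True
      show ?thesis
      proof (cases "itin i = itin j")
        case eq: True
        have "\<sigma> * (- 1 / \<beta>) ^ (N - i) < \<sigma> * (- 1 / \<beta>) ^ (N - j)"
          unfolding \<sigma>_def by (rule tie_order[OF assms(1) tie ij eq True])
        moreover have "point \<beta> t i = point \<beta> t j"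
          by (rule point_cong[OF assms(1) t ij eq])
        ultimately have "\<rho> i < \<rho> j \<longrightarrow> y \<eta> i < y \<eta> j" if "0 < \<eta>" for \<eta>
          unfolding y using that by (auto intro: mult_strict_right_mono)
        moreover have "eventually (\<lambda>\<eta>::real. 0 < \<eta>) (at_right 0)"
          by (simp add: eventually_at_right_less)
        ultimately show ?thesis by (auto elim: eventually_mono)
      next
        case False
        have "\<not> altlex (itin j) (itin i)" using itin_mono[OF ij] True by simp
        then have "altlex (itin i) (itin j)" using False altlex_total by blast
        then have "point \<beta> t i < point \<beta> t j"
          using point_strict_mono[OF assms(1) t unit ij] by blast
        moreover have "((\<lambda>\<eta>. y \<eta> j - y \<eta> i) \<longlongrightarrow> point \<beta> t j - point \<beta> t i) (at_right 0)"
          by (intro tendsto_diff lim)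
        ultimately have "eventually (\<lambda>\<eta>. 0 < y \<eta> j - y \<eta> i) (at_right 0)"
          by (intro order_tendstoD) auto
        then show ?thesis by (auto elim: eventually_mono)
      qed
    qed simp
  qed auto
  ultimately have "eventually (\<lambda>\<eta>. (\<forall>j\<in>{1..N}. 0 < y \<eta> j \<and> y \<eta> j < 1) \<and>
      (\<forall>i\<in>{1..N}. \<forall>j\<in>{1..N}. \<rho> i < \<rho> j \<longrightarrow> y \<eta> i < y \<eta> j)) (at_right 0)"
    by (rule eventually_conj)
  then obtain \<eta> where \<eta>: "\<forall>j\<in>{1..N}. 0 < y \<eta> j \<and> y \<eta> j < 1"
      "\<forall>i\<in>{1..N}. \<forall>j\<in>{1..N}. \<rho> i < \<rho> j \<longrightarrow> y \<eta> i < y \<eta> j"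
    using eventually_happens[of _ "at_right (0::real)"] trivial_limit_at_right_real by blast
  \<comment> \<open>As all perturbed points lie in (0, 1), the letters \<zeta> are their true digits
    and the affine recursion is the map itself.\<close>
  have orbit: "(neg_beta \<beta> ^^ j) (y \<eta> 1) = y \<eta> (Suc j)" if "j < N" for j
    using that
  proof (induction j)
    case (Suc j)
    have "y \<eta> (Suc (Suc j)) = real (\<zeta> (Suc j)) + 1 - \<beta> * y \<eta> (Suc j)"
      using point_Suc[of "Suc j" \<beta> "t + \<sigma> * \<eta>"] Suc.prems assms(1) by (simp add: y_def)
    moreover have "0 < y \<eta> (Suc (Suc j))" "y \<eta> (Suc (Suc j)) \<le> 1"
      using \<eta>(1) Suc.prems by (auto intro: less_imp_le)
    ultimately have "neg_beta \<beta> (y \<eta> (Suc j)) = y \<eta> (Suc (Suc j))" by (rule neg_beta_eqI(1))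
    then show ?case using Suc by simp
  qed simp
  have "y \<eta> 1 \<in> {0<..1}" using \<eta>(1) ref by (auto intro: less_imp_le)
  moreover have "(neg_beta \<beta> ^^ (j - 1)) (y \<eta> 1) = y \<eta> j" if "j \<in> {1..N}" for j
  proof -
    have "j - 1 < N" "Suc (j - 1) = j" using that by auto
    then show ?thesis using orbit[of "j - 1"] by simp
  qed
  ultimately show ?thesis using \<eta>(2) by (intro bexI[of _ "y \<eta> 1"]) auto
qed

theorem eventually_realize_order:
  assumes less: "\<And>j. 1 \<le> j \<Longrightarrow> j < N \<Longrightarrow> altlex (itin j) omega"
    and tie: "\<And>i. 1 \<le> i \<Longrightarrow> i < N \<Longrightarrow> itin i = itin ref \<Longrightarrow> \<rho> i < \<rho> N \<longleftrightarrow> \<rho> ref < \<rho> N"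
  shows "eventually (\<lambda>\<beta>. \<exists>x\<in>{0<..1}. \<forall>i\<in>{1..N}. \<forall>j\<in>{1..N}. \<rho> i < \<rho> j \<longrightarrow>
    (neg_beta \<beta> ^^ (i - 1)) x < (neg_beta \<beta> ^^ (j - 1)) x) (at_right 1)"
proof -
  define P where "P = (\<lambda>j k. (\<forall>x<k. itin j !! x = omega !! x) \<and>
      (if even k then itin j !! k < omega !! k else omega !! k < itin j !! k))"
  have "\<forall>j\<in>{1..<N}. \<exists>k. P j k" using less unfolding altlex_def P_def by simp
  then obtain K where K: "\<And>j. j \<in> {1..<N} \<Longrightarrow> P j (K j)" by metis
  \<comment> \<open>The finitely many itineraries deviate from \<open>omega\<close> within a common
    prefix, where the expansion of 1 agrees with \<open>omega\<close> for \<beta> near 1.\<close>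
  define B where "B = Suc (Max (insert 0 (K ` {1..<N})))"
  have B: "K j < B" if "j \<in> {1..<N}" for j
    using that unfolding B_def by (intro le_imp_less_Suc Max_ge) auto
  have "eventually (\<lambda>\<beta>::real. 1 < \<beta>) (at_right 1)" by (simp add: eventually_at_right_less)
  with eventually_expansion_1[of B] show ?thesis
  proof eventually_elim
    case (elim \<beta>)
    show ?case
    proof (rule realize_order[OF elim(2) _ tie])
      fix j assume j: "1 \<le> j" "j < N"
      have "K j < B" "P j (K j)" using B K j by auto
      then show "\<exists>k. (\<forall>x<k. itin j !! x = expansion \<beta> 1 !! x) \<and>
          (if even k then itin j !! k < expansion \<beta> 1 !! k else expansion \<beta> 1 !! k < itin j !! k) \<and>
          (neg_beta \<beta> ^^ Suc k) 1 < 1"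
        using elim(1) unfolding P_def by (intro exI[of _ "K j"]) (auto simp del: funpow.simps)
    qed
  qed
qed

end

section \<open>Neighbours with equal itineraries\<close>

definition strictly_between :: "nat \<Rightarrow> nat \<Rightarrow> nat \<Rightarrow> bool" where
  "strictly_between a x b \<longleftrightarrow> a < x \<and> x < b \<or> b < x \<and> x < a"

text \<open>An order-reversing orbit spirals. While it moves outward, its last two points are the
  extremes so far. Once a point falls between its two predecessors, this persists, because the map
  carries each gap between consecutive points to the next one and preserves betweenness.\<close>

lemma antitone_orbit_spiral:
  fixes f :: "nat \<Rightarrow> nat"
  assumes anti: "\<And>i j. i < q \<Longrightarrow> j < q \<Longrightarrow> f i < f j \<Longrightarrow> f (Suc j) < f (Suc i)"
    and inj: "inj_on f {..q}" and "Suc k \<le> q"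
  shows "(\<forall>i\<le>Suc k. f k \<le> f i \<and> f i \<le> f (Suc k)) \<or> (\<forall>i\<le>Suc k. f (Suc k) \<le> f i \<and> f i \<le> f k) \<or>
    1 \<le> k \<and> strictly_between (f k) (f (Suc k)) (f (k - 1)) \<and> (\<forall>i\<le>k. \<not> strictly_between (f k) (f i) (f (k - 1)))"
  using assms(3)
proof (induction k)
  case 0
  show ?case by (cases "f 0 \<le> f 1") (auto simp: le_Suc_eq)
next
  case (Suc k)
  have ne: "f i \<noteq> f j" if "i \<le> q" "j \<le> q" "i \<noteq> j" for i j
    using inj that unfolding inj_on_def by auto
  have wanti: "f (Suc j) \<le> f (Suc i)" if "i < q" "j < q" "f i \<le> f j" for i j
    using anti[of i j] ne[of i j] that by (cases "i = j") (auto simp: le_less)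
  have k: "k < q" "Suc k < q" using Suc.prems by auto
  consider (up) "\<forall>i\<le>Suc k. f k \<le> f i \<and> f i \<le> f (Suc k)"
    | (down) "\<forall>i\<le>Suc k. f (Suc k) \<le> f i \<and> f i \<le> f k"
    | (inward) "1 \<le> k" "strictly_between (f k) (f (Suc k)) (f (k - 1))"
      "\<forall>i\<le>k. \<not> strictly_between (f k) (f i) (f (k - 1))"
    using Suc.IH Suc.prems by fastforce
  then show ?case
  proof cases
    case up
    have img: "f (Suc (Suc k)) \<le> f (Suc i) \<and> f (Suc i) \<le> f (Suc k)" if "i \<le> Suc k" for i
      using wanti[of i "Suc k"] wanti[of k i] up that k by simp
    show ?thesis
    proof (cases "f (Suc (Suc k)) \<le> f 0")
      case True
      have "f (Suc (Suc k)) \<le> f i \<and> f i \<le> f (Suc k)" if "i \<le> Suc (Suc k)" for i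
        using img[of "i - 1"] True up that by (cases i) auto
      then show ?thesis by blast
    next
      case False
      \<comment> \<open>A change of direction can occur only at the start: later on,
        \<open>f k\<close> is itself the image of an earlier point and therefore bounds the new
        point.\<close>
      have "k = 0"
      proof (rule ccontr)
        assume "k \<noteq> 0"
        then have "f (Suc (Suc k)) \<le> f k" using img[of "k - 1"] by simp
        then show False using False up by (meson le_trans zero_le)
      qed
      have "f (Suc (Suc 0)) \<le> f 1" using img[of 0] \<open>k = 0\<close> by simp
      moreover have "f (Suc (Suc 0)) \<noteq> f 1" using ne[of "Suc (Suc 0)" 1] Suc.prems \<open>k = 0\<close> by simp
      ultimately have "strictly_between (f 1) (f (Suc (Suc 0))) (f 0)"
        using False \<open>k = 0\<close> by (simp add: strictly_between_def)
      then show ?thesis using \<open>k = 0\<close> by (auto simp: strictly_between_def le_Suc_eq)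
    qed
  next
    case down
    have img: "f (Suc k) \<le> f (Suc i) \<and> f (Suc i) \<le> f (Suc (Suc k))" if "i \<le> Suc k" for i
      using wanti[of "Suc k" i] wanti[of i k] down that k by simp
    show ?thesis
    proof (cases "f 0 \<le> f (Suc (Suc k))")
      case True
      have "f (Suc k) \<le> f i \<and> f i \<le> f (Suc (Suc k))" if "i \<le> Suc (Suc k)" for i
        using img[of "i - 1"] True down that by (cases i) auto
      then show ?thesis by blast
    next
      case False
      have "k = 0"
      proof (rule ccontr)
        assume "k \<noteq> 0"
        then have "f k \<le> f (Suc (Suc k))" using img[of "k - 1"] by simp
        then show False using False down by (meson le_trans zero_le)
      qed
      have "f 1 \<le> f (Suc (Suc 0))" using img[of 0] \<open>k = 0\<close> by simp
      moreover have "f (Suc (Suc 0)) \<noteq> f 1" using ne[of "Suc (Suc 0)" 1] Suc.prems \<open>k = 0\<close> by simp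
      ultimately have "strictly_between (f 1) (f (Suc (Suc 0))) (f 0)"
        using False \<open>k = 0\<close> by (simp add: strictly_between_def)
      then show ?thesis using \<open>k = 0\<close> by (auto simp: strictly_between_def le_Suc_eq)
    qed
  next
    case inward
    have iff: "strictly_between (f (Suc a)) (f (Suc x)) (f (Suc b)) \<longleftrightarrow> strictly_between (f a) (f x) (f b)"
      if "a < q" "x < q" "b < q" for a x b
      using anti[of a x] anti[of x a] anti[of x b] anti[of b x] wanti[of a x] wanti[of x a] wanti[of x b]
        wanti[of b x] that unfolding strictly_between_def by (meson not_le)
    have kk: "Suc (k - 1) = k" using inward(1) by simp
    have "strictly_between (f (Suc k)) (f (Suc (Suc k))) (f k)"
      using iff[of k "Suc k" "k - 1"] inward k kk by simp
    moreover have "\<not> strictly_between (f (Suc k)) (f i) (f k)" if "i \<le> Suc k" for i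
    proof (cases i)
      case 0
      then show ?thesis using inward(2,3) unfolding strictly_between_def by (meson le_less_trans less_trans zero_le)
    next
      case (Suc j)
      then show ?thesis using iff[of k j "k - 1"] inward(3) that k kk by simp
    qed
    ultimately show ?thesis by simp
  qed
qed

text \<open>The last point has orbit points on both sides, which rules out outward motion. Inward
  motion puts it into the gap between its two predecessors, which contains no earlier point.\<close>

lemma antitone_orbit_adjacent:
  fixes f :: "nat \<Rightarrow> nat"
  assumes anti: "\<And>i j. i < q \<Longrightarrow> j < q \<Longrightarrow> f i < f j \<Longrightarrow> f (Suc j) < f (Suc i)"
    and inj: "inj_on f {..q}" and ab: "a < q" "b < q" "f a < f q" "f q < f b"
    and adj: "\<And>i. i < q \<Longrightarrow> f i \<le> f a \<or> f b \<le> f i"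
  shows "\<exists>k. q = Suc (Suc k) \<and> (a = k \<and> b = Suc k \<or> a = Suc k \<and> b = k)"
proof -
  have eq: "i = j" if "f i = f j" "i \<le> q" "j \<le> q" for i j
    using inj that unfolding inj_on_def by auto
  define k where "k = q - 1"
  have q: "q = Suc k" using ab(1) by (simp add: k_def)
  have "a \<noteq> b" using ab by auto
  have "(\<forall>i\<le>Suc k. f k \<le> f i \<and> f i \<le> f (Suc k)) \<or> (\<forall>i\<le>Suc k. f (Suc k) \<le> f i \<and> f i \<le> f k) \<or>
    1 \<le> k \<and> strictly_between (f k) (f (Suc k)) (f (k - 1)) \<and> (\<forall>i\<le>k. \<not> strictly_between (f k) (f i) (f (k - 1)))"
    by (rule antitone_orbit_spiral[OF _ inj]) (use anti q in auto)
  moreover have "\<not> (\<forall>i\<le>Suc k. f k \<le> f i \<and> f i \<le> f (Suc k))"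
    using ab(2,4) q by (metis leD less_imp_le)
  moreover have "\<not> (\<forall>i\<le>Suc k. f (Suc k) \<le> f i \<and> f i \<le> f k)"
    using ab(1,3) q by (metis leD less_imp_le)
  ultimately have "1 \<le> k \<and> strictly_between (f k) (f (Suc k)) (f (k - 1)) \<and> (\<forall>i\<le>k. \<not> strictly_between (f k) (f i) (f (k - 1)))"
    by blast
  then have k: "1 \<le> k" "strictly_between (f k) (f q) (f (k - 1))" "\<not> strictly_between (f k) (f a) (f (k - 1))"
    "\<not> strictly_between (f k) (f b) (f (k - 1))"
    using ab unfolding q by auto
  have "f k \<le> f a \<or> f b \<le> f k" "f (k - 1) \<le> f a \<or> f b \<le> f (k - 1)" using adj q by auto
  then have "f k = f a \<and> f (k - 1) = f b \<or> f k = f b \<and> f (k - 1) = f a"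
    using k(2-4) ab(3,4) unfolding strictly_between_def by linarith
  moreover have "k = a" if "f k = f a" by (rule eq[OF that]) (use ab q in simp_all)
  moreover have "k - 1 = b" if "f (k - 1) = f b" by (rule eq[OF that]) (use ab q in simp_all)
  moreover have "k = b" if "f k = f b" by (rule eq[OF that]) (use ab q in simp_all)
  moreover have "k - 1 = a" if "f (k - 1) = f a" by (rule eq[OF that]) (use ab q in simp_all)
  ultimately have "k = a \<and> k - 1 = b \<or> k = b \<and> k - 1 = a" by blast
  then show ?thesis using k(1) q by (intro exI[of _ "k - 1"]) auto
qed

text \<open>The first two points determine the direction of the whole orbit, so the last point is an
  extreme.\<close>

lemma monotone_orbit_not_between:
  fixes f :: "nat \<Rightarrow> nat"
  assumes mono: "\<And>i j. i < q \<Longrightarrow> j < q \<Longrightarrow> f i < f j \<Longrightarrow> f (Suc i) < f (Suc j)"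
    and inj: "inj_on f {..q}" and ab: "a < q" "b < q" "f a < f q" "f q < f b"
  shows False
proof -
  have ne: "f 0 \<noteq> f 1" using inj ab(1) unfolding inj_on_def by (metis One_nat_def Suc_leI atMost_iff le0 not_gr_zero zero_neq_one less_nat_zero_code)
  show False
  proof (cases "f 0 < f 1")
    case True
    have step: "f i < f (Suc i)" if "i < q" for i
      using that by (induction i) (use True mono in auto)
    have "f b < f q" using ab(2)
      by (rule less_Suc_induct[of b q "\<lambda>i j. j \<le> q \<longrightarrow> f i < f j", THEN mp]) (use step in auto)
    then show False using ab by simp
  next
    case False
    have step: "f (Suc i) < f i" if "i < q" for i
      using that by (induction i) (use False ne mono in auto)
    have "f q < f a" using ab(1)
      by (rule less_Suc_induct[of a q "\<lambda>i j. j \<le> q \<longrightarrow> f j < f i", THEN mp]) (use step in auto)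
    then show False using ab by simp
  qed
qed

lemma sdrop_gcd:
  assumes "sdrop a S = S" "sdrop b S = S"
  shows "sdrop (gcd a b) S = S"
  using assms
proof (induction a b rule: gcd_nat_induct)
  case (step m n)
  have mult: "sdrop (n * k) S = S" for k
  proof (induction k)
    case (Suc k)
    have "sdrop (n * Suc k) S = sdrop (n * k) (sdrop n S)" by (simp add: sdrop_add add.commute)
    then show ?case using Suc step by simp
  qed simp
  have "sdrop (m mod n) S = sdrop (m mod n) (sdrop (n * (m div n)) S)" using mult by simp
  also have "\<dots> = sdrop m S" by (simp add: sdrop_add)
  finally have "sdrop (gcd n (m mod n)) S = S" using step by simp
  then show ?case by (subst gcd_red_nat)
qed simp

context itinerary
begin

lemma sdrop_itin_add: "j + d \<le> N \<Longrightarrow> sdrop d (itin j) = itin (j + d)"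
proof (induction d)
  case (Suc d)
  then have "sdrop (Suc d) (itin j) = stl (itin (j + d))" by (metis add_Suc_right Suc_leD sdrop_stl sdrop.simps(2))
  then show ?case using itin_Stream[of "j + d"] Suc.prems by simp
qed simp

lemma stake_itin: "j + d \<le> N \<Longrightarrow> stake d (itin j) = map \<zeta> [j..<j + d]"
  by (induction d arbitrary: j) (auto simp: itin_Stream upt_conv_Cons simp del: upt_Suc)

text \<open>
  If the itineraries of both neighbours of \<open>N\<close> agree, then they are periodic with period
  \<open>g = gcd (N - l) (N - r)\<close>, and every \<open>g\<close>-th position carries the same itinerary; on these positions the
  shift by \<open>g\<close> is monotone (\<open>g\<close> even) or antitone (\<open>g\<close> odd).
\<close>
lemma equal_neighbour_itineraries:
  assumes l: "1 \<le> l" "l < N" and r: "1 \<le> r" "r < N" and between: "\<rho> l < \<rho> N" "\<rho> N < \<rho> r"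
    and adj: "\<And>i. 1 \<le> i \<Longrightarrow> i < N \<Longrightarrow> \<rho> i \<le> \<rho> l \<or> \<rho> r \<le> \<rho> i"
    and "ref \<in> {l, r}" and eq: "itin l = itin r"
  shows "map \<zeta> [l..<N] = map \<zeta> [r..<N] @ map \<zeta> [r..<N] \<or> map \<zeta> [r..<N] = map \<zeta> [l..<N] @ map \<zeta> [l..<N]"
proof -
  define S where "S = itin N"
  have S: "itin l = S" "itin r = S" using assms(8) eq itin_N S_def by auto
  define c g where "c = min l r" and "g = gcd (N - l) (N - r)"
  define q where "q = (N - c) div g"
  have "sdrop (N - l) S = S" "sdrop (N - r) S = S"
    using sdrop_itin_add[of l "N - l"] sdrop_itin_add[of r "N - r"] l r S S_def by auto
  then have per: "sdrop g S = S" unfolding g_def by (rule sdrop_gcd)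
  have g: "0 < g" "g dvd N - l" "g dvd N - r" using l r by (auto simp: g_def)
  have "g dvd N - c" using g by (auto simp: c_def min_def)
  then have q: "c + q * g = N" using l r by (auto simp: q_def c_def)
  have c: "1 \<le> c" "c < N" "itin c = S" using l r S by (auto simp: c_def min_def)
  have idx: "\<exists>i<q. j = c + i * g" if "c \<le> j" "j < N" "g dvd N - j" for j
  proof -
    have "g dvd (N - c) - (N - j)" by (rule dvd_diff_nat[OF \<open>g dvd N - c\<close> that(3)])
    moreover have "(N - c) - (N - j) = j - c" using that c by simp
    ultimately obtain i where "j - c = g * i" by (metis dvdE)
    then have "j = c + i * g" using that(1) by (simp add: mult.commute)
    moreover have "i < q" using that(2) q \<open>j = c + i * g\<close> g(1) by (metis add_less_cancel_left mult_less_cancel2)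
    ultimately show ?thesis by blast
  qed
  \<comment> \<open>Ranks along the arithmetic progression through \<open>l\<close>,
    \<open>r\<close> and \<open>N\<close>.\<close>
  define f where "f = (\<lambda>i. \<rho> (c + i * g))"
  have pos: "c + i * g \<le> N" if "i \<le> q" for i using that q g(1)
    by (metis add_le_cancel_left mult_le_mono1)
  have itin_c: "itin (c + i * g) = S" if "i \<le> q" for i
  proof -
    have "sdrop (i * g) S = S"
    proof (induction i)
      case (Suc i)
      have "sdrop (Suc i * g) S = sdrop (i * g) (sdrop g S)" by (simp add: sdrop_add add.commute)
      then show ?case using Suc per by simp
    qed simp
    then show ?thesis using sdrop_itin_add[OF pos[OF that]] c(3) by simp
  qed
  have inj_f: "inj_on f {..q}"
  proof (rule inj_onI)
    fix i j assume ij: "i \<in> {..q}" "j \<in> {..q}" "f i = f j"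
    have "c + i * g = c + j * g"
      by (rule inj_onD[OF inj]) (use ij pos c(1) in \<open>auto simp: f_def\<close>)
    then show "i = j" using g(1) by simp
  qed
  have flip: "if even g then f (Suc i) < f (Suc j) else f (Suc j) < f (Suc i)"
    if "i < q" "j < q" "f i < f j" for i j
  proof -
    have e: "c + i * g + g = c + Suc i * g" "c + j * g + g = c + Suc j * g" by simp_all
    have "c + i * g + g \<le> N" "c + j * g + g \<le> N"
      unfolding e using pos[of "Suc i"] pos[of "Suc j"] that by auto
    then have "if even g then \<rho> (c + i * g + g) < \<rho> (c + j * g + g) else \<rho> (c + j * g + g) < \<rho> (c + i * g + g)"
      using tie_flip[of "c + i * g" "c + j * g" g] itin_c[of i] itin_c[of j] that c(1)
      unfolding f_def by simp
    then show ?thesis unfolding f_def e .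
  qed
  obtain a where a: "a < q" "l = c + a * g" using idx[of l] l g c_def by auto
  obtain b where b: "b < q" "r = c + b * g" using idx[of r] r g c_def by auto
  have ab: "f a < f q" "f q < f b" using between a b q by (auto simp: f_def)
  have "odd g"
  proof
    assume "even g"
    then show False using monotone_orbit_not_between[OF _ inj_f a(1) b(1) ab] flip by simp
  qed
  then have "\<exists>k. q = Suc (Suc k) \<and> (a = k \<and> b = Suc k \<or> a = Suc k \<and> b = k)"
  proof (intro antitone_orbit_adjacent[OF _ inj_f a(1) b(1) ab])
    show "f (Suc j) < f (Suc i)" if "i < q" "j < q" "f i < f j" for i j
      using flip[OF that] \<open>odd g\<close> by simp
    show "f i \<le> f a \<or> f b \<le> f i" if "i < q" for i
    proof -
      have "i * g < q * g" using that g(1) by simp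
      then have "c + i * g < N" using q by linarith
      then show ?thesis using adj[of "c + i * g"] c(1) a b by (simp add: f_def)
    qed
  qed
  then obtain q' where q': "q = Suc (Suc q')" "a = q' \<and> b = Suc q' \<or> a = Suc q' \<and> b = q'" by blast
  \<comment> \<open>The neighbours are the last two members of the progression before
    \<open>N\<close>, so their words have lengths g + g and g.\<close>
  define p where "p = c + q' * g"
  have p: "p + g + g = N" "p + g = c + Suc q' * g" using q q'(1) by (auto simp: p_def)
  have "itin (p + g) = S" unfolding p(2) by (rule itin_c) (use q'(1) in simp)
  moreover have "itin p = S" unfolding p_def by (rule itin_c) (use q'(1) in simp)
  ultimately have "itin p = itin (p + g)" by simp
  then have "map \<zeta> [p..<p + g] = map \<zeta> [p + g..<N]"
    using stake_itin[of p g] stake_itin[of "p + g" g] p(1) by simp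
  moreover have "map \<zeta> [p..<N] = map \<zeta> [p..<p + g] @ map \<zeta> [p + g..<N]"
    using upt_add_eq_append[of p "p + g" g] p(1) by simp
  ultimately have "map \<zeta> [p..<N] = map \<zeta> [p + g..<N] @ map \<zeta> [p + g..<N]" by simp
  moreover have "l = p \<and> r = p + g \<or> l = p + g \<and> r = p"
    using q'(2) a(2) b(2) p(2) p_def by metis
  ultimately show ?thesis by auto
qed

end

section \<open>Minimal digits\<close>

locale pattern =
  fixes n :: nat and \<pi> :: "nat \<Rightarrow> nat"
  assumes n: "1 \<le> n" and perm: "\<pi> permutes {1..n}"
begin

lemma inj_perm: "\<pi> i = \<pi> j \<longleftrightarrow> i = j"
  using permutes_inj[OF perm] by (auto simp: inj_def)

lemma perm_range: "1 \<le> i \<Longrightarrow> i \<le> n \<Longrightarrow> 1 \<le> \<pi> i" "1 \<le> i \<Longrightarrow> i \<le> n \<Longrightarrow> \<pi> i \<le> n"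
  using permutes_in_image[OF perm, of i] by auto

lemma inv_perm: "\<pi> (inv \<pi> t) = t" "inv \<pi> (\<pi> i) = i"
  using permutes_inverses[OF perm] by auto

lemma inv_range: "1 \<le> t \<Longrightarrow> t \<le> n \<Longrightarrow> 1 \<le> inv \<pi> t" "1 \<le> t \<Longrightarrow> t \<le> n \<Longrightarrow> inv \<pi> t \<le> n"
  using permutes_in_image[OF permutes_inv[OF perm], of t] by auto

lemma inv_less:
  assumes "1 \<le> t" "t \<le> n" "t \<noteq> \<pi> n"
  shows "inv \<pi> t < n"
  using inv_range[OF assms(1,2)] assms(3) inv_perm(1)[of t] by (cases "inv \<pi> t = n") auto

abbreviation "m \<equiv> pos_max n \<pi>"
abbreviation "l \<equiv> pos_left n \<pi>"
abbreviation "r \<equiv> pos_right n \<pi>"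

lemma pos_max: "1 \<le> m" "m \<le> n" "\<pi> m = n" "1 \<le> i \<Longrightarrow> i \<le> n \<Longrightarrow> \<pi> i \<le> \<pi> m"
  using inv_range[of n] inv_perm perm_range n by (auto simp: pos_max_def)

lemma pos_left:
  assumes "\<pi> n \<noteq> 1"
  shows "1 \<le> l" "l < n" "Suc (\<pi> l) = \<pi> n"
  using inv_range[of "\<pi> n - 1"] inv_less[of "\<pi> n - 1"] inv_perm(1)[of "\<pi> n - 1"] perm_range[of n] n assms
  by (auto simp: pos_left_def)

lemma pos_right:
  assumes "\<pi> n \<noteq> n"
  shows "1 \<le> r" "r < n" "\<pi> r = Suc (\<pi> n)"
  using inv_range[of "\<pi> n + 1"] inv_less[of "\<pi> n + 1"] inv_perm(1)[of "\<pi> n + 1"] perm_range[of n] n assms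
  by (auto simp: pos_right_def)

definition succ_rank :: "nat \<Rightarrow> nat" where
  "succ_rank t = \<pi> (Suc (inv \<pi> t))"

lemma succ_rank_perm: "succ_rank (\<pi> i) = \<pi> (Suc i)"
  by (simp add: succ_rank_def inv_perm)

lemma succ_rank_inj: "succ_rank t = succ_rank t' \<longleftrightarrow> t = t'"
  unfolding succ_rank_def inj_perm by (metis Suc_inject inv_perm(1))

text \<open>Branches are decreasing, so an ascent of \<open>succ_rank\<close> forces a larger digit.
  The successor of position n is unknown; therefore the ranks \<pi> n - 1 and \<pi> n + 1 are
  compared directly, and their jump is booked at \<pi> n - 1.\<close>

definition is_step :: "nat \<Rightarrow> bool" where
  "is_step i \<longleftrightarrow> i \<noteq> \<pi> n \<and> \<pi> n \<noteq> i + 1 \<and> succ_rank i < succ_rank (i + 1) \<or>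
     i + 1 = \<pi> n \<and> \<pi> n \<noteq> n \<and> \<pi> (l + 1) < \<pi> (r + 1)"

definition steps_below :: "nat \<Rightarrow> nat" where
  "steps_below t = card {i. 1 \<le> i \<and> i < t \<and> is_step i}"

lemma z_eq: "z n \<pi> j = steps_below (\<pi> j)"
  by (simp add: z_def steps_below_def is_step_def succ_rank_def)

lemma steps_below_1: "steps_below 1 = 0"
  by (auto simp: steps_below_def)

lemma steps_below_Suc:
  assumes "1 \<le> t"
  shows "steps_below (Suc t) = steps_below t + (if is_step t then 1 else 0)"
proof -
  let ?A = "{i. 1 \<le> i \<and> i < t \<and> is_step i}"
  have "{i. 1 \<le> i \<and> i < Suc t \<and> is_step i} = (if is_step t then insert t ?A else ?A)"
    using assms by (auto simp: less_Suc_eq)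
  moreover have "finite ?A" by (rule finite_subset[of _ "{..<t}"]) auto
  ultimately show ?thesis by (simp add: steps_below_def)
qed

lemma steps_below_step:
  assumes "1 \<le> t" "t \<noteq> \<pi> n" "Suc t \<noteq> \<pi> n"
  shows "steps_below (Suc t) = steps_below t + (if succ_rank t < succ_rank (Suc t) then 1 else 0)"
  using steps_below_Suc[OF assms(1)] assms(2,3) by (simp add: is_step_def)

lemma steps_below_skip:
  assumes "2 \<le> \<pi> n" "Suc (\<pi> n) \<le> n"
  shows "steps_below (Suc (\<pi> n)) = steps_below (\<pi> n - 1) +
    (if succ_rank (\<pi> n - 1) < succ_rank (Suc (\<pi> n)) then 1 else 0)"
proof -
  have "\<not> is_step (\<pi> n)" by (simp add: is_step_def)
  then have "steps_below (Suc (\<pi> n)) = steps_below (Suc (\<pi> n - 1))"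
    using steps_below_Suc[of "\<pi> n"] assms by simp
  also have "\<dots> = steps_below (\<pi> n - 1) + (if is_step (\<pi> n - 1) then 1 else 0)"
    using steps_below_Suc[of "\<pi> n - 1"] assms by simp
  also have "is_step (\<pi> n - 1) \<longleftrightarrow> succ_rank (\<pi> n - 1) < succ_rank (Suc (\<pi> n))"
    using assms by (simp add: is_step_def succ_rank_def pos_left_def pos_right_def)
  finally show ?thesis .
qed

text \<open>Once the rank of position n is left out, \<pi> n - 1 and \<pi> n + 1 become neighbours;
  a transitive relation needs checking on neighbours only.\<close>

lemma rank_chain:
  assumes trans: "\<And>t u v. R t u \<Longrightarrow> R u v \<Longrightarrow> R t v"
    and step: "\<And>t. 1 \<le> t \<Longrightarrow> Suc t \<le> n \<Longrightarrow> t \<noteq> \<pi> n \<Longrightarrow> Suc t \<noteq> \<pi> n \<Longrightarrow> R t (Suc t)"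
    and skip: "2 \<le> \<pi> n \<Longrightarrow> Suc (\<pi> n) \<le> n \<Longrightarrow> R (\<pi> n - 1) (Suc (\<pi> n))"
    and "1 \<le> t" "t < u" "u \<le> n" "t \<noteq> \<pi> n" "u \<noteq> \<pi> n"
  shows "R t u"
  using assms(5-8)
proof (induction u rule: less_induct)
  case (less u)
  show ?case
  proof (cases "u = Suc (\<pi> n)")
    case True
    then have t: "t < \<pi> n" using less.prems by auto
    then have sk: "R (\<pi> n - 1) u" using skip True less.prems assms(4) by simp
    show ?thesis
    proof (cases "t = \<pi> n - 1")
      case False
      then have "R t (\<pi> n - 1)" using less.IH[of "\<pi> n - 1"] less.prems t True by simp
      then show ?thesis using sk trans by blast
    qed (use sk in simp)
  next
    case False
    then have st: "R (u - 1) u" using step[of "u - 1"] less.prems assms(4) by (cases u) auto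
    show ?thesis
    proof (cases "t = u - 1")
      case False
      then have "R t (u - 1)" using less.IH[of "u - 1"] less.prems \<open>u \<noteq> Suc (\<pi> n)\<close> assms(4)
        by (cases u) auto
      then show ?thesis using st trans by blast
    qed (use st in simp)
  qed
qed

lemma z_mono_flip:
  assumes "1 \<le> i" "i < n" "1 \<le> j" "j < n" "\<pi> i < \<pi> j"
  shows "z n \<pi> i \<le> z n \<pi> j" "z n \<pi> i = z n \<pi> j \<Longrightarrow> \<pi> (Suc j) < \<pi> (Suc i)"
proof -
  define R where "R = (\<lambda>t u. steps_below t \<le> steps_below u \<and>
    (steps_below t = steps_below u \<longrightarrow> succ_rank u < succ_rank t))"
  have "R (\<pi> i) (\<pi> j)"
  proof (rule rank_chain)
    show "R t v" if "R t u" "R u v" for t u v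
      using that unfolding R_def by auto
    show "R t (Suc t)" if "1 \<le> t" "t \<noteq> \<pi> n" "Suc t \<noteq> \<pi> n" for t
      using steps_below_step[OF that] succ_rank_inj[of t "Suc t"] unfolding R_def
      by (auto split: if_splits)
    show "R (\<pi> n - 1) (Suc (\<pi> n))" if "2 \<le> \<pi> n" "Suc (\<pi> n) \<le> n"
      using steps_below_skip[OF that] succ_rank_inj[of "\<pi> n - 1" "Suc (\<pi> n)"] unfolding R_def
      by (auto split: if_splits)
  qed (use assms perm_range inj_perm in auto)
  then show "z n \<pi> i \<le> z n \<pi> j" "z n \<pi> i = z n \<pi> j \<Longrightarrow> \<pi> (Suc j) < \<pi> (Suc i)"
    unfolding R_def z_eq succ_rank_perm by auto
qed

text \<open>Digits of a realisation increase at every counted step and possibly elsewhere, so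
  \<open>w\<close> - \<open>z\<close> is nondecreasing in the rank. The second claim says this
  without subtraction; the first follows from it at the lowest rank, where \<open>z\<close> is
  0.\<close>

lemma z_minimal:
  assumes mono: "\<And>i j. 1 \<le> i \<Longrightarrow> i < n \<Longrightarrow> 1 \<le> j \<Longrightarrow> j < n \<Longrightarrow> \<pi> i < \<pi> j \<Longrightarrow> w i \<le> w j"
    and strict: "\<And>i j. 1 \<le> i \<Longrightarrow> i < n \<Longrightarrow> 1 \<le> j \<Longrightarrow> j < n \<Longrightarrow> \<pi> i < \<pi> j \<Longrightarrow>
      \<pi> (Suc i) < \<pi> (Suc j) \<Longrightarrow> w i < w j"
    and i: "1 \<le> i" "i < n"
  shows "z n \<pi> i \<le> w i"
    and "1 \<le> j \<Longrightarrow> j < n \<Longrightarrow> \<pi> i < \<pi> j \<Longrightarrow> z n \<pi> j + w i \<le> z n \<pi> i + w j"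
proof -
  define R where "R = (\<lambda>t u. steps_below u + w (inv \<pi> t) \<le> steps_below t + w (inv \<pi> u))"
  have inv_ok: "1 \<le> inv \<pi> t" "inv \<pi> t < n" if "1 \<le> t" "t \<le> n" "t \<noteq> \<pi> n" for t
    using inv_range[of t] inv_less[of t] that by auto
  have w_step: "w (inv \<pi> t) + (if succ_rank t < succ_rank u then 1 else 0) \<le> w (inv \<pi> u)"
    if "1 \<le> t" "t < u" "u \<le> n" "t \<noteq> \<pi> n" "u \<noteq> \<pi> n" for t u
    using mono[OF inv_ok inv_ok, of t u] strict[OF inv_ok inv_ok, of t u] that
    by (auto simp: inv_perm succ_rank_def)
  have R: "R t u" if "1 \<le> t" "t < u" "u \<le> n" "t \<noteq> \<pi> n" "u \<noteq> \<pi> n" for t u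
  proof (rule rank_chain[OF _ _ _ that])
    show "R t v" if "R t u" "R u v" for t u v
      using that unfolding R_def by linarith
    show "R t (Suc t)" if "1 \<le> t" "Suc t \<le> n" "t \<noteq> \<pi> n" "Suc t \<noteq> \<pi> n" for t
      using steps_below_step[OF that(1,3,4)] w_step[of t "Suc t"] that unfolding R_def by simp
    show "R (\<pi> n - 1) (Suc (\<pi> n))" if "2 \<le> \<pi> n" "Suc (\<pi> n) \<le> n"
    proof -
      have "1 \<le> \<pi> n - 1" "\<pi> n - 1 < Suc (\<pi> n)" "\<pi> n - 1 \<noteq> \<pi> n" "Suc (\<pi> n) \<noteq> \<pi> n"
        using that by auto
      note w_step[OF this(1,2) that(2) this(3,4)]
      then show ?thesis using steps_below_skip[OF that] unfolding R_def by simp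
    qed
  qed
  have ne: "\<pi> i \<noteq> \<pi> n" using i inj_perm by auto
  \<comment> \<open>The smallest rank other than \<pi> n. If \<pi> n = 1, no step is booked at rank
    1, so the count is still 0 at rank 2.\<close>
  define t0 where "t0 = (if \<pi> n = 1 then 2 else 1 :: nat)"
  have "steps_below t0 = 0"
    using steps_below_1 steps_below_Suc[of 1] by (simp add: t0_def is_step_def numeral_2_eq_2)
  have t0: "1 \<le> t0" "t0 \<noteq> \<pi> n" "t0 \<le> \<pi> i"
    using perm_range[of i] i ne by (auto simp: t0_def)
  show "z n \<pi> i \<le> w i"
  proof (cases "t0 = \<pi> i")
    case False
    then have "R t0 (\<pi> i)" using R[of t0 "\<pi> i"] t0 ne perm_range[of i] i by simp
    then show ?thesis using \<open>steps_below t0 = 0\<close> by (simp add: R_def z_eq inv_perm)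
  qed (use \<open>steps_below t0 = 0\<close> z_eq in simp)
  show "z n \<pi> j + w i \<le> z n \<pi> i + w j" if "1 \<le> j" "j < n" "\<pi> i < \<pi> j"
  proof -
    have "R (\<pi> i) (\<pi> j)" using R[of "\<pi> i" "\<pi> j"] that ne perm_range[of i] perm_range[of j] i inj_perm[of j n]
      by simp
    then show ?thesis by (simp add: R_def z_eq inv_perm)
  qed
qed

lemma z_n: "\<pi> n = 1 \<Longrightarrow> z n \<pi> n = 0"
  unfolding z_eq using steps_below_1 by simp

text \<open>A common form of both cases: the neighbours are the positions n - 2g and n - g, in
  either order, followed by equal blocks.\<close>

lemma collapsed_blocks:
  assumes "collapsed n \<pi>"
  obtains p g where "1 \<le> p" "1 \<le> g" "n = p + g + g" "l = p \<and> r = p + g \<or> l = p + g \<and> r = p"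
    "\<And>i. i < g \<Longrightarrow> z n \<pi> (p + i) = z n \<pi> (p + g + i)"
proof -
  note result = that
  have n1: "\<pi> n \<noteq> 1" "\<pi> n \<noteq> n" using assms by (auto simp: collapsed_def)
  note lr = pos_left[OF n1(1)] pos_right[OF n1(2)]
  have main: thesis if "a = l \<and> b = r \<or> a = r \<and> b = l"
    "map (z n \<pi>) [a..<n] = map (z n \<pi>) [b..<n] @ map (z n \<pi>) [b..<n]" for a b
  proof -
    define g where "g = n - b"
    have ab: "1 \<le> a" "a < n" "1 \<le> b" "b < n" using that(1) lr by auto
    have "n - a = g + g" using arg_cong[OF that(2), of length] by (simp add: g_def)
    then have g: "1 \<le> g" "n = a + g + g" "b = a + g" using ab by (auto simp: g_def)
    note blocks = that(2)
    have "z n \<pi> (a + i) = z n \<pi> (a + g + i)" if "i < g" for i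
    proof -
      have "map (z n \<pi>) [a..<n] ! i = z n \<pi> (a + i)" using that g by simp
      moreover have "(map (z n \<pi>) [b..<n] @ map (z n \<pi>) [b..<n]) ! i = z n \<pi> (b + i)"
        using that g by (simp add: nth_append)
      ultimately show ?thesis using blocks g(3) by simp
    qed
    moreover have "l = a \<and> r = a + g \<or> l = a + g \<and> r = a" using that(1) g(3) by auto
    ultimately show thesis using result[OF ab(1) g(1,2)] by blast
  qed
  show thesis using assms main[of l r] main[of r l] by (auto simp: collapsed_def subword_def Let_def)
qed

lemma collapsed_I:
  assumes "\<pi> n \<noteq> 1" "\<pi> n \<noteq> n"
    "map (z n \<pi>) [l..<n] = map (z n \<pi>) [r..<n] @ map (z n \<pi>) [r..<n] \<or>
     map (z n \<pi>) [r..<n] = map (z n \<pi>) [l..<n] @ map (z n \<pi>) [l..<n]"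
  shows "collapsed n \<pi>"
  using assms by (auto simp: collapsed_def subword_def Let_def)

lemma itineraryI:
  assumes "\<And>i j. 1 \<le> i \<Longrightarrow> i < n \<Longrightarrow> 1 \<le> j \<Longrightarrow> j < n \<Longrightarrow> \<pi> i < \<pi> j \<Longrightarrow> \<zeta> i \<le> \<zeta> j"
    "\<And>i j. 1 \<le> i \<Longrightarrow> i < n \<Longrightarrow> 1 \<le> j \<Longrightarrow> j < n \<Longrightarrow> \<pi> i < \<pi> j \<Longrightarrow> \<zeta> i = \<zeta> j \<Longrightarrow> \<pi> (Suc j) < \<pi> (Suc i)"
    and c: "c = l \<and> \<pi> n \<noteq> 1 \<or> c = r \<and> \<pi> n \<noteq> n"
  shows "itinerary n \<pi> \<zeta> c"
proof
  show "inj_on \<pi> {1..n}" using inj_perm by (auto simp: inj_on_def)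
  show "1 \<le> c" "c < n" using c pos_left pos_right by auto
  show "\<pi> i < \<pi> c \<longleftrightarrow> \<pi> i < \<pi> n" if "1 \<le> i" "i < n" "i \<noteq> c" for i
  proof -
    have "\<pi> i \<noteq> \<pi> n" "\<pi> i \<noteq> \<pi> c" using that inj_perm by auto
    then show ?thesis using c pos_left(3) pos_right(3) by auto
  qed
qed (use assms in auto)

lemma itinerary_z: "c = l \<and> \<pi> n \<noteq> 1 \<or> c = r \<and> \<pi> n \<noteq> n \<Longrightarrow> itinerary n \<pi> (z n \<pi>) c"
  by (rule itineraryI) (use z_mono_flip in auto)

text \<open>Raising the digits from some rank on keeps them monotone and creates no new
  equalities.\<close>

lemma itinerary_z_alt:
  assumes "c = l \<and> \<pi> n \<noteq> 1 \<or> c = r \<and> \<pi> n \<noteq> n"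
  shows "itinerary n \<pi> (z_alt n \<pi> k) c"
proof (rule itineraryI[OF _ _ assms])
  fix i j assume ij: "1 \<le> i" "i < n" "1 \<le> j" "j < n" "\<pi> i < \<pi> j"
  note z = z_mono_flip[OF ij]
  show "z_alt n \<pi> k i \<le> z_alt n \<pi> k j" using z ij(5) by (auto simp: z_alt_def)
  show "\<pi> (Suc j) < \<pi> (Suc i)" if "z_alt n \<pi> k i = z_alt n \<pi> k j"
    using z ij(5) that by (auto simp: z_alt_def split: if_splits)
qed

text \<open>
  If \<open>\<pi> n = 1\<close>, then the point at position \<open>n\<close> may be taken so close to \<open>0\<close> that its image is the maximum
  of the orbit; thus position \<open>n + 1\<close> is added, which \<open>\<pi>\<close> fixes.
\<close>
lemma itinerary_extended:
  assumes "\<pi> n = 1"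
  shows "itinerary (Suc n) \<pi> (z n \<pi>) m"
proof
  have Suc: "\<pi> (Suc n) = Suc n" using perm by (rule permutes_not_in) simp
  show "inj_on \<pi> {1..Suc n}" using inj_perm by (auto simp: inj_on_def)
  show "1 \<le> m" "m < Suc n" using pos_max by auto
  fix i assume i: "1 \<le> i" "i < Suc n"
  show "\<pi> i < \<pi> m \<longleftrightarrow> \<pi> i < \<pi> (Suc n)" if "i \<noteq> m"
    using that i perm_range[of i] pos_max(3) Suc inj_perm[of i m] by auto
  fix j assume j: "1 \<le> j" "j < Suc n" and less: "\<pi> i < \<pi> j"
  have "j \<noteq> n" using less assms perm_range[of i] i by auto
  then have jn: "j < n" using j by simp
  show "z n \<pi> i \<le> z n \<pi> j"
    using z_mono_flip(1)[OF i(1) _ j(1) jn less] i z_n[OF assms] by (cases "i = n") auto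
  show "\<pi> (Suc j) < \<pi> (Suc i)" if "z n \<pi> i = z n \<pi> j"
    using z_mono_flip(2)[OF i(1) _ j(1) jn less that] i perm_range(2)[of "Suc j"] jn Suc
    by (cases "i = n") auto
qed

lemma B_minus_eq_1_iff:
  "B_minus n \<pi> = 1 \<longleftrightarrow>
    (\<forall>e>1. \<exists>\<beta>. 1 < \<beta> \<and> \<beta> < e \<and> \<pi> \<in> allowed_patterns {0<..1} (neg_beta \<beta>) n)"
proof
  assume B: "B_minus n \<pi> = 1"
  show "\<forall>e>1. \<exists>\<beta>. 1 < \<beta> \<and> \<beta> < e \<and> \<pi> \<in> allowed_patterns {0<..1} (neg_beta \<beta>) n"
  proof (intro allI impI)
    fix e :: real assume "1 < e"
    then have "B_minus n \<pi> < ereal e" using B by (simp add: one_ereal_def)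
    then show "\<exists>\<beta>. 1 < \<beta> \<and> \<beta> < e \<and> \<pi> \<in> allowed_patterns {0<..1} (neg_beta \<beta>) n"
      unfolding B_minus_def INF_less_iff by auto
  qed
next
  assume *: "\<forall>e>1. \<exists>\<beta>. 1 < \<beta> \<and> \<beta> < e \<and> \<pi> \<in> allowed_patterns {0<..1} (neg_beta \<beta>) n"
  show "B_minus n \<pi> = 1"
  proof (rule antisym)
    show "1 \<le> B_minus n \<pi>"
      unfolding B_minus_def by (rule INF_greatest) (auto simp: one_ereal_def)
    show "B_minus n \<pi> \<le> 1"
    proof (rule ccontr)
      assume "\<not> B_minus n \<pi> \<le> 1"
      then have "1 < B_minus n \<pi>" by simp
      then obtain e where e: "ereal 1 < ereal e" "ereal e < B_minus n \<pi>"
        using ereal_dense2 by (metis one_ereal_def)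
      then obtain \<beta> where \<beta>: "1 < \<beta>" "\<beta> < e" "\<pi> \<in> allowed_patterns {0<..1} (neg_beta \<beta>) n"
        using * by auto
      then have "B_minus n \<pi> \<le> ereal \<beta>" unfolding B_minus_def by (intro INF_lower) auto
      also have "\<dots> < ereal e" using \<beta> by simp
      finally show False using e(2) by simp
    qed
  qed
qed

text \<open>All itineraries are bounded by that of the position \<open>M\<close> of largest rank, so
  they lie strictly below \<open>omega\<close>. \<open>N\<close> may exceed n, since a realised
  order on more positions restricts to the pattern.\<close>

lemma B_minus_eq_1I:
  assumes it: "itinerary N \<pi> \<zeta> c" and "n \<le> N" "M \<in> {1..N}" "\<And>j. j \<in> {1..N} \<Longrightarrow> \<pi> j \<le> \<pi> M"
    and a: "itinerary.itin N \<zeta> c M = cycle ((phi ^^ k) [0])"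
    and tie: "\<And>i. 1 \<le> i \<Longrightarrow> i < N \<Longrightarrow> itinerary.itin N \<zeta> c i = itinerary.itin N \<zeta> c c \<Longrightarrow>
      \<pi> i < \<pi> N \<longleftrightarrow> \<pi> c < \<pi> N"
  shows "B_minus n \<pi> = 1"
proof -
  interpret itinerary N \<pi> \<zeta> c by (rule it)
  have less: "altlex (itin j) omega" if "1 \<le> j" "j < N" for j
  proof -
    have "\<not> altlex (itin M) (itin j)" using itin_mono[of j M] assms(3,4) that by simp
    then show ?thesis using a cycle_phi_less_omega altle_less_trans by metis
  qed
  have ev: "eventually (\<lambda>\<beta>. \<exists>x\<in>{0<..1}. \<forall>i\<in>{1..N}. \<forall>j\<in>{1..N}. \<pi> i < \<pi> j \<longrightarrow>
    (neg_beta \<beta> ^^ (i - 1)) x < (neg_beta \<beta> ^^ (j - 1)) x) (at_right 1)"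
    by (rule eventually_realize_order[OF less tie])
  show ?thesis
    unfolding B_minus_eq_1_iff
  proof (intro allI impI)
    fix e :: real assume "1 < e"
    then have "eventually (\<lambda>\<beta>. \<beta> \<in> {1<..<e}) (at_right 1)" by (rule eventually_at_right_real)
    with ev have "eventually (\<lambda>\<beta>. \<beta> \<in> {1<..<e} \<and> (\<exists>x\<in>{0<..1}. \<forall>i\<in>{1..N}. \<forall>j\<in>{1..N}. \<pi> i < \<pi> j \<longrightarrow>
      (neg_beta \<beta> ^^ (i - 1)) x < (neg_beta \<beta> ^^ (j - 1)) x)) (at_right 1)"
      by eventually_elim simp
    from eventually_happens'[OF trivial_limit_at_right_real this] obtain \<beta> x where \<beta>: "1 < \<beta>" "\<beta> < e" and x: "x \<in> {0<..1}"
      and ord: "\<And>i j. i \<in> {1..N} \<Longrightarrow> j \<in> {1..N} \<Longrightarrow> \<pi> i < \<pi> j \<Longrightarrow>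
        (neg_beta \<beta> ^^ (i - 1)) x < (neg_beta \<beta> ^^ (j - 1)) x"
      unfolding greaterThanLessThan_iff by blast
    have iff: "\<pi> i < \<pi> j \<longleftrightarrow> (neg_beta \<beta> ^^ (i - 1)) x < (neg_beta \<beta> ^^ (j - 1)) x"
      if "i \<in> {1..n}" "j \<in> {1..n}" for i j
    proof -
      have "i \<in> {1..N}" "j \<in> {1..N}" using that assms(2) by auto
      note o = ord[OF this] ord[OF this(2,1)]
      show ?thesis
      proof (cases "\<pi> i" "\<pi> j" rule: linorder_cases)
        case equal
        then show ?thesis using inj_perm by simp
      qed (use o in auto)
    qed
    have inj: "inj_on (\<lambda>i. (neg_beta \<beta> ^^ i) x) {0..<n}"
    proof (rule inj_onI)
      fix i j assume ij: "i \<in> {0..<n}" "j \<in> {0..<n}" "(neg_beta \<beta> ^^ i) x = (neg_beta \<beta> ^^ j) x"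
      then have "\<not> \<pi> (Suc i) < \<pi> (Suc j)" "\<not> \<pi> (Suc j) < \<pi> (Suc i)"
        using iff[of "Suc i" "Suc j"] iff[of "Suc j" "Suc i"] by auto
      then have "\<pi> (Suc i) = \<pi> (Suc j)" by simp
      then show "i = j" unfolding inj_perm by simp
    qed
    have "has_pattern (neg_beta \<beta>) x n \<pi>"
      unfolding has_pattern_def using perm inj iff by blast
    then show "\<exists>\<beta>. 1 < \<beta> \<and> \<beta> < e \<and> \<pi> \<in> allowed_patterns {0<..1} (neg_beta \<beta>) n"
      using \<beta> x unfolding allowed_patterns_def by blast
  qed
qed

end

section \<open>Realisations\<close>

lemma expansion_mono:
  assumes "1 < \<beta>" "0 < x" "x \<le> y"
  shows "\<not> altlex (expansion \<beta> y) (expansion \<beta> x)"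
proof
  assume "altlex (expansion \<beta> y) (expansion \<beta> x)"
  then obtain k where "\<forall>i<k. expansion \<beta> y !! i = expansion \<beta> x !! i"
    "if even k then expansion \<beta> y !! k < expansion \<beta> x !! k else expansion \<beta> x !! k < expansion \<beta> y !! k"
    unfolding altlex_def by blast
  then show False
    using assms(2,3)
  proof (induction k arbitrary: x y)
    case (0 x y)
    have "\<beta> * x \<le> \<beta> * y" using 0(4) assms(1) by simp
    then have "nat \<lfloor>\<beta> * x\<rfloor> \<le> nat \<lfloor>\<beta> * y\<rfloor>" by (intro nat_mono floor_mono)
    then show ?case using 0(2) expansion_nth[of \<beta> x 0] expansion_nth[of \<beta> y 0] by simp
  next
    case (Suc k x y)
    have "expansion \<beta> y !! 0 = expansion \<beta> x !! 0" using Suc.prems(1) by blast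
    then have "nat \<lfloor>\<beta> * y\<rfloor> = nat \<lfloor>\<beta> * x\<rfloor>" unfolding expansion_nth by simp
    moreover have "0 \<le> \<lfloor>\<beta> * y\<rfloor>" "0 \<le> \<lfloor>\<beta> * x\<rfloor>" using Suc.prems(3,4) assms(1) by auto
    ultimately have eq: "\<lfloor>\<beta> * y\<rfloor> = \<lfloor>\<beta> * x\<rfloor>" by linarith
    have "\<beta> * x \<le> \<beta> * y" using Suc.prems(4) assms(1) by simp
    then have le: "neg_beta \<beta> y \<le> neg_beta \<beta> x" using eq by (simp add: neg_beta_def)
    have nth: "expansion \<beta> z !! Suc i = expansion \<beta> (neg_beta \<beta> z) !! i" for z i
      using arg_cong[OF expansion_Stream[of \<beta> z], of "\<lambda>s. s !! Suc i"] by simp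
    show ?case
    proof (rule Suc.IH[OF _ _ _ le])
      show "\<forall>i<k. expansion \<beta> (neg_beta \<beta> x) !! i = expansion \<beta> (neg_beta \<beta> y) !! i"
        using Suc.prems(1) nth by (metis Suc_less_eq)
      show "0 < neg_beta \<beta> y" using neg_beta_in[of \<beta> y] by simp
    qed (use Suc.prems(2) nth in \<open>auto split: if_splits\<close>)
  qed
qed

lemma sset_singleton_cycle: "sset a \<subseteq> {c} \<Longrightarrow> a = cycle [c]"
  by (rule constant_stream) (use snth_sset in blast)

section \<open>Ties in concrete patterns and sufficiency\<close>

context pattern
begin

text \<open>A position tied with \<open>c\<close> but on the other side of n would have the other
  neighbour between them in rank or be that neighbour; monotonicity would then give both neighbours
  the same itinerary.\<close>

lemma tie_if_neighbours_differ:
  assumes it: "itinerary n \<pi> \<zeta> c" and c: "c = l \<or> c = r" and n1: "\<pi> n \<noteq> 1" "\<pi> n \<noteq> n"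
    and ne: "itinerary.itin n \<zeta> c l \<noteq> itinerary.itin n \<zeta> c r"
    and i: "1 \<le> i" "i < n" "itinerary.itin n \<zeta> c i = itinerary.itin n \<zeta> c c"
  shows "\<pi> i < \<pi> n \<longleftrightarrow> \<pi> c < \<pi> n"
proof -
  interpret itinerary n \<pi> \<zeta> c by (rule it)
  note lr = pos_left[OF n1(1)] pos_right[OF n1(2)]
  have pin: "\<pi> i \<noteq> \<pi> n" using i inj_perm by simp
  have lr_le: "\<not> altlex (itin r) (itin l)" by (rule itin_mono) (use lr in auto)
  show ?thesis
  proof (rule ccontr)
    assume *: "\<not> (\<pi> i < \<pi> n \<longleftrightarrow> \<pi> c < \<pi> n)"
    show False
    proof (cases "c = l")
      case True
      then have "\<pi> r \<le> \<pi> i" using * pin lr by auto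
      then have "\<not> altlex (itin i) (itin r)" by (intro itin_mono) (use lr i in auto)
      then show False using lr_le i(3) True ne altlex_total[of "itin l" "itin r"] by auto
    next
      case False
      then have "\<pi> i \<le> \<pi> l" using * pin lr c by auto
      then have "\<not> altlex (itin l) (itin i)" by (intro itin_mono) (use lr i in auto)
      then show False using lr_le i(3) False c ne altlex_total[of "itin l" "itin r"] by auto
    qed
  qed
qed

text \<open>If \<pi> n is extreme, all other positions lie on one side. Otherwise equal itineraries
  of \<open>l\<close> and \<open>r\<close> would produce the doubled block that defines
  \<open>collapsed\<close>.\<close>

lemma tie_if_not_collapsed:
  assumes c: "c = l \<and> \<pi> n \<noteq> 1 \<or> c = r \<and> \<pi> n \<noteq> n" and nc: "\<not> collapsed n \<pi>"
    and i: "1 \<le> i" "i < n" "itinerary.itin n (z n \<pi>) c i = itinerary.itin n (z n \<pi>) c c"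
  shows "\<pi> i < \<pi> n \<longleftrightarrow> \<pi> c < \<pi> n"
proof -
  have pin: "\<pi> i \<noteq> \<pi> n" using i inj_perm by simp
  have it: "itinerary n \<pi> (z n \<pi>) c" by (rule itinerary_z[OF c])
  interpret itinerary n \<pi> "z n \<pi>" c by (rule it)
  consider (max) "\<pi> n = n" | (min) "\<pi> n = 1" "\<pi> n \<noteq> n" | (inner) "\<pi> n \<noteq> 1" "\<pi> n \<noteq> n" by blast
  then show ?thesis
  proof cases
    case max
    then have "\<pi> c < \<pi> n" using c pos_left by auto
    moreover have "\<pi> i < \<pi> n" using max perm_range[of i] i pin by auto
    ultimately show ?thesis by simp
  next
    case min
    then have "\<pi> n < \<pi> c" using c pos_right by auto
    moreover have "\<pi> n < \<pi> i" using min perm_range[of i] i pin by auto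
    ultimately show ?thesis by simp
  next
    case inner
    note lr = pos_left[OF inner(1)] pos_right[OF inner(2)]
    have "itin l \<noteq> itin r"
    proof
      assume eq: "itin l = itin r"
      have "map (z n \<pi>) [l..<n] = map (z n \<pi>) [r..<n] @ map (z n \<pi>) [r..<n] \<or>
        map (z n \<pi>) [r..<n] = map (z n \<pi>) [l..<n] @ map (z n \<pi>) [l..<n]"
      proof (rule equal_neighbour_itineraries[OF lr(1,2,4,5)])
        show "\<pi> j \<le> \<pi> l \<or> \<pi> r \<le> \<pi> j" if "1 \<le> j" "j < n" for j
          using that lr inj_perm[of j n] by (auto simp: not_le)
      qed (use c lr eq in auto)
      then show False using collapsed_I[OF inner] nc by blast
    qed
    then show ?thesis using tie_if_neighbours_differ[OF it _ inner _ i] c by blast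
  qed
qed

text \<open>Since \<open>z\<close> agrees along the blocks, the order of the ranks of l + i and r +
  i alternates with i. The parity distinction in \<open>z_alt\<close> puts the extra jump at the
  larger of the two for i = k, so the k-th letters differ.\<close>

lemma collapsed_itin_neq:
  assumes "collapsed n \<pi>" "k \<in> gap_indices n \<pi>" and c: "c = l \<or> c = r"
  shows "itinerary.itin n (z_alt n \<pi> k) c l \<noteq> itinerary.itin n (z_alt n \<pi> k) c r"
proof -
  have n1: "\<pi> n \<noteq> 1" "\<pi> n \<noteq> n" using assms(1) by (auto simp: collapsed_def)
  note lr = pos_left[OF n1(1)] pos_right[OF n1(2)]
  obtain p g where pg: "1 \<le> p" "1 \<le> g" "n = p + g + g" "l = p \<and> r = p + g \<or> l = p + g \<and> r = p"
    "\<And>i. i < g \<Longrightarrow> z n \<pi> (p + i) = z n \<pi> (p + g + i)"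
    using collapsed_blocks[OF assms(1)] by blast
  have k: "k < g" using assms(2) pg(4) by (auto simp: gap_indices_def)
  have zlr: "z n \<pi> (l + i) = z n \<pi> (r + i)" if "i < g" for i
    using pg(4) pg(5)[OF that] by auto
  have bd: "l + i < n" "r + i < n" if "i < g" for i using that pg(3,4) by auto
  have alt: "if even i then \<pi> (l + i) < \<pi> (r + i) else \<pi> (r + i) < \<pi> (l + i)" if "i < g" for i
    using that
  proof (induction i)
    case (Suc i)
    then have i: "i < g" by simp
    have "1 \<le> l + i" "1 \<le> r + i" using lr by auto
    then show ?case
      using Suc.IH[OF i] z_mono_flip(2)[of "l + i" "r + i"] z_mono_flip(2)[of "r + i" "l + i"] bd[OF i] zlr[OF i]
      by (auto split: if_splits)
  qed (use lr in simp)
  have "z_alt n \<pi> k (l + k) \<noteq> z_alt n \<pi> k (r + k)"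
    using alt[OF k] zlr[OF k] by (cases "even k") (auto simp: z_alt_def)
  moreover have "c = l \<and> \<pi> n \<noteq> 1 \<or> c = r \<and> \<pi> n \<noteq> n" using c n1 by blast
  then have it: "itinerary n \<pi> (z_alt n \<pi> k) c" by (rule itinerary_z_alt)
  moreover have "itinerary.itin n (z_alt n \<pi> k) c j !! k = z_alt n \<pi> k (j + k)" if "j + k < n" for j
    unfolding itinerary.itin_def[OF it] using that by (simp add: shift_snth_less)
  ultimately show ?thesis using bd[OF k] by metis
qed

lemma gap_indices_nonempty:
  assumes "collapsed n \<pi>"
  shows "gap_indices n \<pi> \<noteq> {}" "finite (gap_indices n \<pi>)"
proof -
  obtain p g where pg: "1 \<le> p" "1 \<le> g" "n = p + g + g" "l = p \<and> r = p + g \<or> l = p + g \<and> r = p"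
    by (rule collapsed_blocks[OF assms])
  have "gap_indices n \<pi> = {..<g}" using pg(4) by (auto simp: gap_indices_def)
  then show "gap_indices n \<pi> \<noteq> {}" "finite (gap_indices n \<pi>)" using pg(2) by (auto simp: lessThan_empty_iff)
qed

text \<open>The prefix of length n - m preserves the order if this number is even and reverses it
  otherwise. The side is chosen so that replacing the tail by the periodic word of the neighbour can
  only lower the itinerary of the maximum.\<close>

definition neighbour :: nat where
  "neighbour = (if even (n - m) then l else r)"

lemma not_max_if_odd: "odd (n - m) \<Longrightarrow> \<pi> n \<noteq> n"
  using pos_max(3) inj_perm by (metis diff_self_eq_0 even_zero)

lemma neighbour:
  assumes "\<not> (even (n - m) \<and> \<pi> n = 1)"
  shows "neighbour = l \<and> \<pi> n \<noteq> 1 \<or> neighbour = r \<and> \<pi> n \<noteq> n"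
proof (cases "even (n - m)")
  case False
  then show ?thesis using not_max_if_odd by (simp add: neighbour_def)
qed (use assms in \<open>auto simp: neighbour_def\<close>)

lemma a_seq_min: "even (n - m) \<Longrightarrow> \<pi> n = 1 \<Longrightarrow> a_seq n \<pi> = cycle (map (z n \<pi>) [m..<Suc n])"
  using z_n pos_max(2) by (simp add: a_seq_def Let_def subword_def)

lemma a_seq_not_collapsed:
  assumes "\<not> (even (n - m) \<and> \<pi> n = 1)" "\<not> collapsed n \<pi>"
  shows "a_seq n \<pi> = itinerary.itin n (z n \<pi>) neighbour m"
  using assms unfolding itinerary.itin_def[OF itinerary_z[OF neighbour[OF assms(1)]]]
  by (auto simp: a_seq_def Let_def subword_def neighbour_def)

lemma a_seq_collapsed:
  assumes "collapsed n \<pi>"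
  shows "a_seq n \<pi> = altlex_min ((\<lambda>i. itinerary.itin n (z_alt n \<pi> i) neighbour m) ` gap_indices n \<pi>)"
proof -
  have "\<pi> n \<noteq> 1" using assms by (auto simp: collapsed_def)
  then have "itinerary.itin n (z_alt n \<pi> i) neighbour m =
      map (z_alt n \<pi> i) [m..<n] @- cycle (map (z_alt n \<pi> i) [neighbour..<n])" for i
    using itinerary.itin_def[OF itinerary_z_alt[OF neighbour]] by simp
  then show ?thesis
    using assms \<open>\<pi> n \<noteq> 1\<close> by (cases "even (n - m)") (auto simp: a_seq_def Let_def subword_def neighbour_def)
qed

lemma itin_extended:
  assumes "\<pi> n = 1"
  shows "itinerary.itin (Suc n) (z n \<pi>) m (Suc n) = cycle (map (z n \<pi>) [m..<Suc n])"
  unfolding itinerary.itin_def[OF itinerary_extended[OF assms]] by simp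

lemma perm_Suc_n: "\<pi> (Suc n) = Suc n"
  using perm by (rule permutes_not_in) simp

lemma extended_max: "j \<in> {1..Suc n} \<Longrightarrow> \<pi> j \<le> \<pi> (Suc n)"
  using perm_range[of j] perm_Suc_n by (cases "j = Suc n") auto

theorem B_minus_eq_1_if:
  assumes a: "a_seq n \<pi> = cycle ((phi ^^ k) [0])"
  shows "B_minus n \<pi> = 1"
proof -
  consider (min) "even (n - m)" "\<pi> n = 1" | (nc) "\<not> (even (n - m) \<and> \<pi> n = 1)" "\<not> collapsed n \<pi>"
    | (coll) "collapsed n \<pi>" by blast
  then show ?thesis
  proof cases
    case min
    show ?thesis
    proof (rule B_minus_eq_1I[OF itinerary_extended[OF min(2)] _ _ extended_max])
      show "itinerary.itin (Suc n) (z n \<pi>) m (Suc n) = cycle ((phi ^^ k) [0])"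
        using itin_extended[OF min(2)] a_seq_min[OF min] a by simp
      show "\<pi> i < \<pi> (Suc n) \<longleftrightarrow> \<pi> m < \<pi> (Suc n)" if "1 \<le> i" "i < Suc n" for i
        using that perm_range[of i] pos_max(3) perm_Suc_n by auto
    qed (use n in auto)
  next
    case nc
    note c = neighbour[OF nc(1)]
    show ?thesis
      by (rule B_minus_eq_1I[OF itinerary_z[OF c], of m])
        (use pos_max a a_seq_not_collapsed[OF nc] tie_if_not_collapsed[OF c nc(2)] in auto)
  next
    case coll
    have n1: "\<pi> n \<noteq> 1" "\<pi> n \<noteq> n" using coll by (auto simp: collapsed_def)
    then have c: "neighbour = l \<and> \<pi> n \<noteq> 1 \<or> neighbour = r \<and> \<pi> n \<noteq> n" using neighbour by blast
    let ?S = "(\<lambda>i. itinerary.itin n (z_alt n \<pi> i) neighbour m) ` gap_indices n \<pi>"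
    have "altlex_min ?S \<in> ?S" using altlex_min_least[of ?S] gap_indices_nonempty[OF coll] by blast
    then obtain i where i: "i \<in> gap_indices n \<pi>" "itinerary.itin n (z_alt n \<pi> i) neighbour m = cycle ((phi ^^ k) [0])"
      using a a_seq_collapsed[OF coll] by auto
    note it = itinerary_z_alt[OF c, of i]
    have "neighbour = l \<or> neighbour = r" using c by blast
    note tie = tie_if_neighbours_differ[OF it this n1 collapsed_itin_neq[OF coll i(1) this]]
    show ?thesis
      by (rule B_minus_eq_1I[OF it, of m]) (use pos_max i(2) tie in auto)
  qed
qed

lemma itin_classification:
  assumes it: "itinerary N \<pi> \<zeta> c" and "M \<in> {1..N}" "\<And>j. j \<in> {1..N} \<Longrightarrow> \<pi> j \<le> \<pi> M"
    and dig: "\<And>j. 1 \<le> j \<Longrightarrow> j < N \<Longrightarrow> \<zeta> j \<le> 1"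
    and le: "\<not> altlex omega (itinerary.itin N \<zeta> c M)"
  shows "\<exists>k. itinerary.itin N \<zeta> c M = cycle ((phi ^^ k) [0])"
proof -
  interpret itinerary N \<pi> \<zeta> c by (rule it)
  have "\<zeta> j \<in> {0, 1}" if "1 \<le> j" "j < N" for j using dig[OF that] by auto
  then have "\<zeta> ` {M..<N} \<union> \<zeta> ` {c..<N} \<subseteq> {0, 1}"
    using assms(2) ref(1) by (intro Un_least image_subsetI) auto
  then have "sset (itin M) \<subseteq> {0, 1}" by (rule order_trans[OF sset_itin])
  then show ?thesis
    using shift_maximal_le_omega[OF _ itin_shift_maximal[OF assms(2,3)] le finite_shifts_itin[OF assms(2)]]
    by blast
qed

end

section \<open>Digits of a realised pattern\<close>

locale realization = pattern +
  fixes \<beta> x :: real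
  assumes beta: "1 < \<beta>" "\<beta> < 2" and x: "0 < x" "x \<le> 1" and realizes: "has_pattern (neg_beta \<beta>) x n \<pi>"
begin

definition orbit :: "nat \<Rightarrow> real" where
  "orbit j = (neg_beta \<beta> ^^ (j - 1)) x"

definition digit :: "nat \<Rightarrow> nat" where
  "digit j = nat \<lfloor>\<beta> * orbit j\<rfloor>"

lemma orbit_Suc: "1 \<le> j \<Longrightarrow> orbit (Suc j) = neg_beta \<beta> (orbit j)"
  by (cases j) (auto simp: orbit_def)

lemma orbit_range: "0 < orbit j" "orbit j \<le> 1"
proof -
  have "0 < (neg_beta \<beta> ^^ i) x \<and> (neg_beta \<beta> ^^ i) x \<le> 1" for i
    using x neg_beta_in by (cases i) auto
  then show "0 < orbit j" "orbit j \<le> 1" by (simp_all add: orbit_def)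
qed

lemma orbit_step: "1 \<le> j \<Longrightarrow> orbit (Suc j) = real (digit j) + 1 - \<beta> * orbit j"
  using orbit_Suc[of j] orbit_range[of j] beta by (simp add: digit_def neg_beta_def)

lemma orbit_less_iff:
  assumes "i \<in> {1..n}" "j \<in> {1..n}"
  shows "\<pi> i < \<pi> j \<longleftrightarrow> orbit i < orbit j"
  using realizes assms unfolding has_pattern_def orbit_def by blast

lemma digit_le_1: "digit j \<le> 1"
proof -
  have "\<beta> * orbit j < 2 * 1" using orbit_range[of j] beta by (intro mult_less_le_imp_less) auto
  then have "\<lfloor>\<beta> * orbit j\<rfloor> < 2" by (simp add: floor_less_iff)
  then show ?thesis unfolding digit_def by linarith
qed

lemma digit_mono:
  assumes "1 \<le> i" "i < n" "1 \<le> j" "j < n" "\<pi> i < \<pi> j"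
  shows "digit i \<le> digit j" "\<pi> (Suc i) < \<pi> (Suc j) \<Longrightarrow> digit i < digit j"
proof -
  have less: "orbit i < orbit j" using orbit_less_iff[of i j] assms by simp
  then have "\<beta> * orbit i \<le> \<beta> * orbit j" using beta by simp
  then show le: "digit i \<le> digit j" unfolding digit_def by (intro nat_mono floor_mono)
  assume "\<pi> (Suc i) < \<pi> (Suc j)"
  then have "orbit (Suc i) < orbit (Suc j)" using orbit_less_iff[of "Suc i" "Suc j"] assms by simp
  moreover have "\<beta> * orbit i < \<beta> * orbit j" using less beta by simp
  ultimately have "digit i \<noteq> digit j" using orbit_step[of i] orbit_step[of j] assms by auto
  then show "digit i < digit j" using le by simp
qed

text \<open>At j both numbers are squeezed to 1, so the excess of the digits over \<open>z\<close>
  is 0 there. The excess grows with the rank, hence vanishes below j; above j the value 1 is already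
  maximal.\<close>

lemma digit_eq_z:
  assumes "1 \<le> j" "j < n" "z n \<pi> j \<noteq> 0" "1 \<le> i" "i < n"
  shows "digit i = z n \<pi> i"
proof -
  have ge: "z n \<pi> k \<le> digit k" if "1 \<le> k" "k < n" for k
    by (rule z_minimal(1)[of digit, OF _ _ that]) (use digit_mono in auto)
  have slope: "z n \<pi> j + digit i \<le> z n \<pi> i + digit j" if "\<pi> i < \<pi> j"
    by (rule z_minimal(2)[of digit i, OF _ _ assms(4,5) assms(1,2) that]) (use digit_mono in auto)
  consider "\<pi> i < \<pi> j" | "i = j" | "\<pi> j < \<pi> i" using inj_perm[of i j] by linarith
  then show ?thesis
  proof cases
    case 1
    then show ?thesis using slope ge[OF assms(4,5)] digit_le_1[of j] assms(3) by linarith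
  next
    case 2
    then show ?thesis using ge[OF assms(4,5)] digit_le_1[of j] assms(3) by simp
  next
    case 3
    then show ?thesis using z_mono_flip(1)[OF assms(1,2,4,5)] ge[OF assms(4,5)] digit_le_1[of i] assms(3) by linarith
  qed
qed

lemma expansion_orbit:
  assumes "1 \<le> j" "j \<le> k"
  shows "expansion \<beta> (orbit j) = map digit [j..<k] @- expansion \<beta> (orbit k)"
  using assms(2)
proof (induction rule: inc_induct)
  case (step i)
  then have "expansion \<beta> (orbit i) = digit i ## expansion \<beta> (orbit (Suc i))"
    using expansion_Stream[of \<beta> "orbit i"] orbit_Suc[of i] assms(1) by (simp add: digit_def)
  then show ?case using step by (simp add: upt_conv_Cons)
qed simp

lemma orbit_word_map:
  assumes "1 \<le> j"
  shows "orbit (j + d) = word_map \<beta> (map digit [j..<j + d]) (orbit j)"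
proof (induction d)
  case (Suc d)
  then show ?case using orbit_step[of "j + d"] assms by (simp add: word_map_append)
qed simp

text \<open>
  Equal blocks would make the \<open>g\<close>-th iterate affine with slope \<open>(- \<beta>)\<^sup>g\<close> on the last points, which pushes
  the point at position \<open>n\<close> out of the interval between its neighbours.
\<close>
lemma blocks_differ:
  assumes p: "1 \<le> p" "1 \<le> g" "n = p + g + g" "l = p \<and> r = p + g \<or> l = p + g \<and> r = p"
    and n1: "\<pi> n \<noteq> 1" "\<pi> n \<noteq> n" and eq: "\<And>i. i < g \<Longrightarrow> digit (p + i) = digit (p + g + i)"
  shows False
proof -
  note lr = pos_left[OF n1(1)] pos_right[OF n1(2)]
  have "map digit [p..<p + g] = map digit [p + g..<p + g + g]"
    by (rule nth_equalityI) (use eq in auto)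
  then have "orbit (p + g) - orbit n = (- \<beta>) ^ g * (orbit p - orbit (p + g))"
    using orbit_word_map[of p g] orbit_word_map[of "p + g" g] p
      word_map_diff[of \<beta> "map digit [p..<p + g]" "orbit p" "orbit (p + g)"] by simp
  then have "\<bar>orbit (p + g) - orbit n\<bar> = \<beta> ^ g * \<bar>orbit p - orbit (p + g)\<bar>"
    using beta by (simp add: abs_mult power_abs)
  also have "\<dots> \<ge> 1 * \<bar>orbit p - orbit (p + g)\<bar>"
    using beta by (intro mult_right_mono one_le_power) auto
  finally have "\<bar>orbit p - orbit (p + g)\<bar> \<le> \<bar>orbit (p + g) - orbit n\<bar>" by simp
  moreover have "orbit l < orbit n" "orbit n < orbit r"
    using orbit_less_iff[of l n] orbit_less_iff[of n r] lr n by auto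
  ultimately show False using p(4) by auto
qed

text \<open>The order of the points n and \<open>neighbour\<close> gives the order of u and qu, and
  hence that of u and the periodic q; prefixing the word from m to n turns it into an upper bound by
  the expansion of the maximal point, which is at most that of 1.\<close>

lemma itin_le_expansion_1:
  assumes it: "itinerary n \<pi> \<zeta> neighbour" and nb: "\<not> (even (n - m) \<and> \<pi> n = 1)"
    and dig: "\<And>j. 1 \<le> j \<Longrightarrow> j < n \<Longrightarrow> \<zeta> j = digit j"
  shows "\<not> altlex (expansion \<beta> 1) (itinerary.itin n \<zeta> neighbour m)"
proof -
  note c = neighbour[OF nb]
  have c_range: "1 \<le> neighbour" "neighbour < n" using c pos_left pos_right by auto
  define u where "u = expansion \<beta> (orbit n)"
  define q where "q = map digit [neighbour..<n]"
  have q: "q \<noteq> []" using c_range by (simp add: q_def)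
  have maps: "map \<zeta> [m..<n] = map digit [m..<n]" "map \<zeta> [neighbour..<n] = q"
    using dig pos_max(1) c_range by (auto simp: q_def)
  have itin: "itinerary.itin n \<zeta> neighbour m = map digit [m..<n] @- cycle q"
    unfolding itinerary.itin_def[OF it] maps by (rule refl)
  have qu: "q @- u = expansion \<beta> (orbit neighbour)"
    using expansion_orbit[of neighbour n] c_range by (simp add: q_def u_def)
  have mu: "map digit [m..<n] @- u = expansion \<beta> (orbit m)"
    using expansion_orbit[of m n] pos_max by (simp add: u_def)
  have "\<not> altlex (map digit [m..<n] @- u) (map digit [m..<n] @- cycle q)"
  proof (cases "even (n - m)")
    case True
    then have "neighbour = l" "\<pi> n \<noteq> 1" using nb by (auto simp: neighbour_def)
    then have "orbit neighbour \<le> orbit n" using orbit_less_iff[of l n] pos_left n by auto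
    then have "\<not> altlex u (q @- u)" unfolding qu unfolding u_def by (rule expansion_mono[OF beta(1) orbit_range(1)])
    then have "\<not> altlex u (cycle q)" using altlex_cycle_right[OF q] by blast
    then show ?thesis using True by (simp add: altlex_shift)
  next
    case False
    then have "neighbour = r" "\<pi> n \<noteq> n" using not_max_if_odd by (auto simp: neighbour_def)
    then have "orbit n \<le> orbit neighbour" using orbit_less_iff[of n r] pos_right n by auto
    then have "\<not> altlex (q @- u) u" unfolding qu unfolding u_def by (rule expansion_mono[OF beta(1) orbit_range(1)])
    then have "\<not> altlex (cycle q) u" using altlex_cycle_left[OF q] by blast
    then show ?thesis using False by (simp add: altlex_shift)
  qed
  moreover have "\<not> altlex (expansion \<beta> 1) (expansion \<beta> (orbit m))"
    by (rule expansion_mono[OF beta(1) orbit_range])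
  ultimately show ?thesis unfolding itin mu by (metis altle_trans)
qed

text \<open>Here a = v0a with v of even length. If the expansion of 1 were below \<open>a\<close>,
  cancelling v would leave the expansion of the point n below 0a. This forces its digit to be 0 and
  puts \<open>a\<close> below the expansion of the next point, which is at most that of 1.\<close>

lemma extended_le_expansion_1:
  assumes "even (n - m)" "\<pi> n = 1" and dig: "\<And>j. 1 \<le> j \<Longrightarrow> j < n \<Longrightarrow> z n \<pi> j = digit j"
  shows "\<not> altlex (expansion \<beta> 1) (cycle (map (z n \<pi>) [m..<Suc n]))"
proof
  define a where "a = cycle (map (z n \<pi>) [m..<Suc n])"
  define v where "v = map digit [m..<n]"
  assume "altlex (expansion \<beta> 1) (cycle (map (z n \<pi>) [m..<Suc n]))"
  then have less: "altlex (expansion \<beta> 1) a" by (simp add: a_def)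
  have "map (z n \<pi>) [m..<Suc n] = v @ [0]" using dig pos_max z_n[OF assms(2)] by (auto simp: v_def)
  then have a: "a = v @- 0 ## a"
    unfolding a_def using cycle_decomp[of "v @ [0]"] by simp
  have top: "\<not> altlex (expansion \<beta> 1) (expansion \<beta> (orbit j))" for j
    by (rule expansion_mono[OF beta(1) orbit_range])
  have "expansion \<beta> (orbit m) = v @- expansion \<beta> (orbit n)"
    using expansion_orbit[of m n] pos_max by (simp add: v_def)
  then have "altlex (v @- expansion \<beta> (orbit n)) (v @- 0 ## a)"
    using altle_less_trans[OF _ less, of "expansion \<beta> (orbit m)"] top[of m] a by simp
  then have "altlex (expansion \<beta> (orbit n)) (0 ## a)" using assms(1) by (simp add: altlex_shift v_def)
  moreover have "expansion \<beta> (orbit n) = digit n ## expansion \<beta> (orbit (Suc n))"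
    using expansion_orbit[of n "Suc n"] n by simp
  ultimately have "altlex a (expansion \<beta> (orbit (Suc n)))" by (simp add: altlex_Stream)
  then show False using top[of "Suc n"] less altlex_trans by blast
qed

end

section \<open>Necessity\<close>

context pattern
begin

lemma exists_realization:
  assumes "B_minus n \<pi> = 1" "1 < e"
  obtains \<beta> x where "realization n \<pi> \<beta> x" "\<beta> < e"
proof -
  have "1 < min e 2" using assms(2) by simp
  then obtain \<beta> where \<beta>: "1 < \<beta>" "\<beta> < min e 2" "\<pi> \<in> allowed_patterns {0<..1} (neg_beta \<beta>) n"
    using assms(1) unfolding B_minus_eq_1_iff by blast
  then obtain x where x: "x \<in> {0<..1}" "has_pattern (neg_beta \<beta>) x n \<pi>"
    unfolding allowed_patterns_def by blast
  have "realization n \<pi> \<beta> x"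
    by unfold_locales (use \<beta> x in auto)
  then show thesis using that \<beta>(2) by simp
qed

text \<open>A strict inequality \<open>altlex omega a\<close> is decided by a finite prefix, on
  which the expansion of 1 already agrees with \<open>omega\<close> for some realisation close
  enough to 1.\<close>

lemma le_omegaI:
  assumes B: "B_minus n \<pi> = 1"
    and le: "\<And>\<beta> x. realization n \<pi> \<beta> x \<Longrightarrow> \<not> altlex (expansion \<beta> 1) a"
  shows "\<not> altlex omega a"
proof
  assume "altlex omega a"
  then obtain k where k: "\<forall>i<k. omega !! i = a !! i"
    "if even k then omega !! k < a !! k else a !! k < omega !! k"
    unfolding altlex_def by blast
  obtain b where b: "1 < b" "\<And>\<beta>. 1 < \<beta> \<Longrightarrow> \<beta> < b \<Longrightarrow> \<forall>i<Suc k. expansion \<beta> 1 !! i = omega !! i"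
    using eventually_expansion_1[of "Suc k"] unfolding eventually_at_right_field by blast
  obtain \<beta> x where real: "realization n \<pi> \<beta> x" and "\<beta> < b"
    by (rule exists_realization[OF B b(1)])
  have "1 < \<beta>" using real by (rule realization.beta)
  then have "\<forall>i<Suc k. expansion \<beta> 1 !! i = omega !! i" using b(2) \<open>\<beta> < b\<close> by blast
  then have "altlex (expansion \<beta> 1) a"
    unfolding altlex_def using k by (intro exI[of _ k]) auto
  then show False using le[OF real] by blast
qed

lemma z_le_1:
  assumes B: "B_minus n \<pi> = 1" and j: "1 \<le> j" "j < n"
  shows "z n \<pi> j \<le> 1"
proof -
  obtain \<beta> x where real: "realization n \<pi> \<beta> x"
    by (rule exists_realization[OF B, of 2]) auto
  interpret realization n \<pi> \<beta> x by (rule real)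
  show ?thesis using digit_eq_z[OF j _ j] digit_le_1[of j] by (cases "z n \<pi> j = 0") auto
qed

lemma a_seq_zero:
  assumes nc: "\<not> collapsed n \<pi>" and zero: "\<And>j. 1 \<le> j \<Longrightarrow> j < n \<Longrightarrow> z n \<pi> j = 0"
  shows "a_seq n \<pi> = cycle [0]"
proof (cases "even (n - m) \<and> \<pi> n = 1")
  case True
  have "z n \<pi> j = 0" if "m \<le> j" "j \<le> n" for j
    using that pos_max(1) zero z_n True by (cases "j = n") auto
  then have "set (map (z n \<pi>) [m..<Suc n]) \<subseteq> {0}" by auto
  moreover have "map (z n \<pi>) [m..<Suc n] \<noteq> []" using pos_max(2) by simp
  ultimately have "sset (a_seq n \<pi>) \<subseteq> {0}"
    using a_seq_min True sset_cycle_subset by (metis order_trans)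
  then show ?thesis by (rule sset_singleton_cycle)
next
  case False
  interpret itinerary n \<pi> "z n \<pi>" neighbour by (rule itinerary_z[OF neighbour[OF False]])
  have "z n \<pi> ` {m..<n} \<union> z n \<pi> ` {neighbour..<n} \<subseteq> {0}" using zero pos_max(1) ref by auto
  then have "sset (itin m) \<subseteq> {0}" by (rule order_trans[OF sset_itin])
  then show ?thesis using a_seq_not_collapsed[OF False nc] sset_singleton_cycle by metis
qed

lemma a_seq_if_not_collapsed:
  assumes B: "B_minus n \<pi> = 1" and nc: "\<not> collapsed n \<pi>" and nz: "1 \<le> j" "j < n" "z n \<pi> j \<noteq> 0"
  shows "\<exists>k. a_seq n \<pi> = cycle ((phi ^^ k) [0])"
proof (cases "even (n - m) \<and> \<pi> n = 1")
  case True
  then have min: "even (n - m)" "\<pi> n = 1" by auto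
  note eq = itin_extended[OF min(2)] a_seq_min[OF min]
  have "\<exists>k. itinerary.itin (Suc n) (z n \<pi>) m (Suc n) = cycle ((phi ^^ k) [0])"
  proof (rule itin_classification[OF itinerary_extended[OF min(2)] _ extended_max])
    show "z n \<pi> i \<le> 1" if "1 \<le> i" "i < Suc n" for i
      using that z_le_1[OF B] z_n[OF min(2)] by (cases "i = n") auto
    show "\<not> altlex omega (itinerary.itin (Suc n) (z n \<pi>) m (Suc n))"
      unfolding eq
    proof (rule le_omegaI[OF B])
      fix \<beta> x assume "realization n \<pi> \<beta> x"
      then interpret realization n \<pi> \<beta> x .
      show "\<not> altlex (expansion \<beta> 1) (cycle (map (z n \<pi>) [m..<Suc n]))"
        by (rule extended_le_expansion_1[OF min]) (use digit_eq_z[OF nz] in simp)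
    qed
  qed auto
  then show ?thesis unfolding eq .
next
  case False
  note it = itinerary_z[OF neighbour[OF False]]
  have "\<exists>k. itinerary.itin n (z n \<pi>) neighbour m = cycle ((phi ^^ k) [0])"
  proof (rule itin_classification[OF it])
    show "\<not> altlex omega (itinerary.itin n (z n \<pi>) neighbour m)"
    proof (rule le_omegaI[OF B])
      fix \<beta> x assume "realization n \<pi> \<beta> x"
      then interpret realization n \<pi> \<beta> x .
      show "\<not> altlex (expansion \<beta> 1) (itinerary.itin n (z n \<pi>) neighbour m)"
        by (rule itin_le_expansion_1[OF it False]) (use digit_eq_z[OF nz] in simp)
    qed
  qed (use pos_max z_le_1[OF B] in auto)
  then show ?thesis using a_seq_not_collapsed[OF False nc] by simp
qed

text \<open>
  A realised collapsed pattern has \<open>z = 0\<close>, so the map is antitone along the whole orbit; the orbit then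
  spirals inwards and the neighbours of \<open>n\<close> are the positions \<open>n - 1\<close> and \<open>n - 2\<close>.
\<close>
lemma collapsed_structure:
  assumes B: "B_minus n \<pi> = 1" and coll: "collapsed n \<pi>"
  shows "\<And>j. 1 \<le> j \<Longrightarrow> j < n \<Longrightarrow> z n \<pi> j = 0"
    and "3 \<le> n" "l = n - 2 \<and> r = n - 1 \<or> l = n - 1 \<and> r = n - 2"
proof -
  have n1: "\<pi> n \<noteq> 1" "\<pi> n \<noteq> n" using coll by (auto simp: collapsed_def)
  note lr = pos_left[OF n1(1)] pos_right[OF n1(2)]
  obtain p g where pg: "1 \<le> p" "1 \<le> g" "n = p + g + g" "l = p \<and> r = p + g \<or> l = p + g \<and> r = p"
    and blocks: "\<And>i. i < g \<Longrightarrow> z n \<pi> (p + i) = z n \<pi> (p + g + i)"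
    using collapsed_blocks[OF coll] by blast
  show zero: "z n \<pi> j = 0" if j: "1 \<le> j" "j < n" for j
  proof (rule ccontr)
    assume nz: "z n \<pi> j \<noteq> 0"
    obtain \<beta> x where real: "realization n \<pi> \<beta> x"
      by (rule exists_realization[OF B, of 2]) auto
    interpret realization n \<pi> \<beta> x by (rule real)
    have "digit (p + i) = digit (p + g + i)" if "i < g" for i
      using digit_eq_z[OF j nz, of "p + i"] digit_eq_z[OF j nz, of "p + g + i"] blocks[OF that] that pg by simp
    then show False by (rule blocks_differ[OF pg n1])
  qed
  define a b where "a = l - p" and "b = r - p"
  have ab: "p + a = l" "p + b = r" "a < g + g" "b < g + g" using pg by (auto simp: a_def b_def)
  define f where "f = (\<lambda>i. \<pi> (p + i))"
  have "\<exists>k. g + g = Suc (Suc k) \<and> (a = k \<and> b = Suc k \<or> a = Suc k \<and> b = k)"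
  proof (rule antitone_orbit_adjacent[of "g + g" f])
    show "f (Suc j) < f (Suc i)" if "i < g + g" "j < g + g" "f i < f j" for i j
      using z_mono_flip(2)[of "p + i" "p + j"] zero[of "p + i"] zero[of "p + j"] that pg by (simp add: f_def)
    show "inj_on f {..g + g}" using inj_perm by (auto simp: inj_on_def f_def)
    have "p + (g + g) = n" using pg(3) by simp
    then show "f a < f (g + g)" "f (g + g) < f b" using lr ab by (auto simp: f_def)
    show "f i \<le> f a \<or> f b \<le> f i" if "i < g + g" for i
      using inj_perm[of "p + i" n] lr ab that pg(3) by (auto simp: f_def)
  qed (use ab in auto)
  then have "g = 1" using pg(2,4) ab by auto
  then show "3 \<le> n" "l = n - 2 \<and> r = n - 1 \<or> l = n - 1 \<and> r = n - 2" using pg by auto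
qed

text \<open>Blocks have length 1, so 0 is the only gap index. In a realisation the digits of
  \<open>l\<close> and \<open>r\<close> differ by \<open>blocks_differ\<close>; the only jump
  therefore lies between their ranks, where \<open>z_alt\<close> with index 0 puts it.\<close>

lemma a_seq_if_collapsed:
  assumes B: "B_minus n \<pi> = 1" and coll: "collapsed n \<pi>"
  shows "\<exists>k. a_seq n \<pi> = cycle ((phi ^^ k) [0])"
proof -
  have n1: "\<pi> n \<noteq> 1" "\<pi> n \<noteq> n" using coll by (auto simp: collapsed_def)
  note lr = pos_left[OF n1(1)] pos_right[OF n1(2)]
  note str = collapsed_structure[OF B coll]
  have nb: "\<not> (even (n - m) \<and> \<pi> n = 1)" using n1 by simp
  note it = itinerary_z_alt[OF neighbour[OF nb], of 0]
  have "gap_indices n \<pi> = {0}" using str(2,3) by (auto simp: gap_indices_def)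
  then have a: "a_seq n \<pi> = itinerary.itin n (z_alt n \<pi> 0) neighbour m"
    unfolding a_seq_collapsed[OF coll] by (intro altlex_min_eqI) auto
  have alt: "z_alt n \<pi> 0 j = (if \<pi> r \<le> \<pi> j then 1 else 0)" if "1 \<le> j" "j < n" for j
    using str(1)[OF that] by (simp add: z_alt_def)
  have "\<exists>k. itinerary.itin n (z_alt n \<pi> 0) neighbour m = cycle ((phi ^^ k) [0])"
  proof (rule itin_classification[OF it])
    show "\<not> altlex omega (itinerary.itin n (z_alt n \<pi> 0) neighbour m)"
    proof (rule le_omegaI[OF B])
      fix \<beta> x assume "realization n \<pi> \<beta> x"
      then interpret realization n \<pi> \<beta> x .
      have "digit l \<noteq> digit r"
      proof
        assume eq: "digit l = digit r"
        show False
        proof (rule blocks_differ[of "n - 2" 1])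
          show "digit (n - 2 + i) = digit (n - 2 + 1 + i)" if "i < 1" for i
            using that eq str(2,3) by (auto simp: numeral_2_eq_2 Suc_diff_Suc)
        qed (use str n1 in auto)
      qed
      then have lr01: "digit l = 0" "digit r = 1"
        using digit_mono(1)[of l r] lr digit_le_1[of l] digit_le_1[of r] by auto
      have "z_alt n \<pi> 0 j = digit j" if j: "1 \<le> j" "j < n" for j
      proof (cases "\<pi> r \<le> \<pi> j")
        case True
        have "1 \<le> digit j"
        proof (cases "j = r")
          case False
          then have "\<pi> r < \<pi> j" using True inj_perm[of r j] by auto
          then show ?thesis using digit_mono(1)[of r j] lr j lr01 by simp
        qed (use lr01 in simp)
        then show ?thesis using alt[OF j] True digit_le_1[of j] by simp
      next
        case False
        then have "\<pi> j \<le> \<pi> l" using inj_perm[of j n] j lr by auto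
        have "digit j = 0"
        proof (cases "j = l")
          case False
          then have "\<pi> j < \<pi> l" using \<open>\<pi> j \<le> \<pi> l\<close> inj_perm[of j l] by auto
          then show ?thesis using digit_mono(1)[of j l] lr j lr01 by simp
        qed (use lr01 in simp)
        then show ?thesis using alt[OF j] False by simp
      qed
      then show "\<not> altlex (expansion \<beta> 1) (itinerary.itin n (z_alt n \<pi> 0) neighbour m)"
        by (rule itin_le_expansion_1[OF it nb])
    qed
  qed (use pos_max alt in auto)
  then show ?thesis using a by simp
qed

theorem a_seq_if_B_minus_eq_1:
  assumes "B_minus n \<pi> = 1"
  shows "\<exists>k. a_seq n \<pi> = cycle ((phi ^^ k) [0])"
proof (cases "collapsed n \<pi>")
  case False
  show ?thesis
  proof (cases "\<exists>j. 1 \<le> j \<and> j < n \<and> z n \<pi> j \<noteq> 0")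
    case True
    then show ?thesis using a_seq_if_not_collapsed[OF assms False] by blast
  next
    case nz: False
    then have "a_seq n \<pi> = cycle ((phi ^^ 0) [0])" using a_seq_zero[OF False] by simp
    then show ?thesis by blast
  qed
qed (use a_seq_if_collapsed[OF assms] in blast)

end

theorem theorem2:
  fixes n :: nat and \<pi> :: "nat \<Rightarrow> nat"
  assumes "n \<ge> 1" and "\<pi> permutes {1..n}"
  shows "B_minus n \<pi> = 1 \<longleftrightarrow> (\<exists>k::nat. a_seq n \<pi> = cycle ((phi ^^ k) [0]))"
proof -
  interpret pattern n \<pi> by unfold_locales (use assms in auto)
  show ?thesis using B_minus_eq_1_if a_seq_if_B_minus_eq_1 by blast
qed

end
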